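(* Let $X$ be either $\mathbb{R}^N$ (finite-dimensional case) or $L^2(\Omega)$ (infinite-dimensional case), let $\sigma$ be the corresponding nonnegative interaction matrix or interaction function, and let $A:X\to X$ be the associated interaction operator. Assume that the directed graph associated to $\sigma$ is strongly connected. Let $y:[0,+\infty)\to X$ solve $\dot y(t)=Ay(t)$, $y(0)=y^{\mathrm{in}}\in X$, and let $\bar y^v=\langle y(t),v\rangle\,e$ be its (time-independent) weighted mean. Then there exists $\rho>0$ such that, for any $\varepsilon\in(0,\rho)$, there exists $M_\varepsilon>0$ satisfying $$\|y(t)-\bar y^v\|\le M_\varepsilon\,\|y^{\mathrm{in}}-\bar y^v\|\,e^{(-\rho+\varepsilon)t},\qquad\forall t\ge0.$$
   Context: Finite-dimensional case: $X=\mathbb{R}^N$ with the Euclidean scalar product $\langle\cdot,\cdot\rangle$ and norm $\|\cdot\|$; $\sigma=(\sigma_{ij})\in\mathbb{R}^{N\times N}$ with $\sigma_{ij}\ge 0$; $e=(1,\dots,1)^\intercal$; $A$ is the matrix with $A_{ij}=\sigma_{ij}$ for $i\ne j$ and $A_{ii}=-\sum_{k\neq i}\sigma_{ik}$, i.e. $(Ay)_i=\sum_j\sigma_{ij}(y_j-y_i)$; $A^*$ is the transpose. The directed graph associated to $\sigma$ has vertices $1,\dots,N$ and an edge from $i$ to $j$ when $\sigma_{ij}>0$. It is strongly connected if, for any pair $(i,j)$ with $i\ne j$, there is a sequence of distinct indices $(i_0,\dots,i_r)$, $r\ge1$, with $i_0=i$, $i_r=j$ and $\sigma_{i_ki_{k+1}}>0$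 for $0\le k\le r-1$. Infinite-dimensional case: $\Omega\subset\mathbb{R}^d$ ($d\ge1$) is a bounded open set with Lebesgue measure $|\Omega|=1$; $X=L^2(\Omega)$ with its usual scalar product $\langle\cdot,\cdot\rangle$ and norm $\|\cdot\|$; $\sigma\in L^\infty(\Omega^2)$ is nonnegative, with no symmetry assumed; $e$ is the constant function $1$; $A:L^2(\Omega)\to L^2(\Omega)$ is the bounded operator $(Az)(x)=\int_\Omega\sigma(x,x_* )(z(x_* )-z(x))\,\mathrm{d}x_*$ for a.e. $x\in\Omega$; $A^*$ is its adjoint; $S(x)=\int_\Omega\sigma(x,x_* )\,\mathrm{d}x_*$. The directed graph associated to $\sigma$ has as vertices the Lebesgue points $x\in\Omega$ of $\sigma$, i.e. those such that $x_*\mapsto\sigma(x,x_* )$ is defined almost everywhere in $\Omega$; for vertices $x_1\ne x_2$, $(x_1,x_2)$ is an arc if $x_2$ belongs to the essential support of $\sigma(x_1,\cdot)$. The graph is strongly connected if (1) for any Lebesgue points $x\neq x_*$ there exist pairwise distinct Lebesgue points $x_0,\dots,x_r$, $r\ge1$, with $x_0=x$, $x_r=x_*$ and $x_{k+1}\in\operatorname{ess\,supp}\sigma(x_k,\cdot)$ for $0\le k\le r-1$; and (2) $\delta:=\operatorname{ess\,inf}S>0$. In both cases, under the strong connectivity assumption, $v$ denotes the unique element of $\ker A^*$ with $v>0$ (coordinatewise, respectively almost everywhere) and $\langle v,e\rangle=1$; since $A^*v=0$, the quantity $\langle y(t),v\rangle$ is constant in time along solutions of $\dot y=Ay$.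
   Formalization: In the infinite-dimensional case, existence and a.e. uniqueness of the positive normalized v in ker A* is an explicit hypothesis, because strong connectivity as defined does not imply it (e.g. two interlaced everywhere-dense sets that do not interact). *)

theory Defs
  imports "HOL-Analysis.Analysis" "HOL-Probability.Essential_Supremum"
begin

text \<open>A path is a list \<open>[i\<^sub>0, \<dots>, i\<^sub>r]\<close> of pairwise distinct vertices with \<open>r \<ge> 1\<close>.\<close>

definition strongly_connected_on :: "'a set \<Rightarrow> ('a \<Rightarrow> 'a \<Rightarrow> bool) \<Rightarrow> bool" where
  "strongly_connected_on V E \<longleftrightarrow>
     (\<forall>x\<in>V. \<forall>z\<in>V. x \<noteq> z \<longrightarrow>
        (\<exists>p. length p \<ge> 2 \<and> distinct p \<and> set p \<subseteq> V \<and> hd p = x \<and> last p = z \<and> successively E p))"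


section \<open>Finite-dimensional case\<close>

definition interaction_matrix :: "real^'n^'n \<Rightarrow> real^'n^'n" where
  "interaction_matrix \<sigma> =
     (\<chi> i j. if i = j then - (\<Sum>k \<in> UNIV - {i}. \<sigma> $ i $ k) else \<sigma> $ i $ j)"

definition graph_strongly_connected :: "real^'n^'n \<Rightarrow> bool" where
  "graph_strongly_connected \<sigma> \<longleftrightarrow> strongly_connected_on UNIV (\<lambda>i j. \<sigma> $ i $ j > 0)"

text \<open>Here \<^term>\<open>vec 1\<close> is the vector \<open>e = (1, \<dots>, 1)\<close>.\<close>

definition weight_vector :: "real^'n^'n \<Rightarrow> real^'n" where
  "weight_vector \<sigma> =
     (THE v. transpose (interaction_matrix \<sigma>) *v v = 0 \<and> (\<forall>i. v $ i > 0) \<and> v \<bullet> vec 1 = 1)"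

definition weighted_mean :: "real^'n \<Rightarrow> real^'n \<Rightarrow> real^'n" where
  "weighted_mean v z = (z \<bullet> v) *\<^sub>R vec 1"

definition solves_consensus :: "real^'n^'n \<Rightarrow> (real \<Rightarrow> real^'n) \<Rightarrow> bool" where
  "solves_consensus \<sigma> y \<longleftrightarrow>
     (\<forall>t\<ge>0. (y has_vector_derivative (interaction_matrix \<sigma> *v y t)) (at t within {0..}))"


section \<open>Infinite-dimensional case\<close>

text \<open>
  Elements of \<open>L\<^sup>2(\<Omega>)\<close> and \<open>L\<^sup>\<infinity>(\<Omega>\<^sup>2)\<close> are handled through representatives: functions on
  the whole space of which only the values on \<open>\<Omega>\<close> matter, equality being equality almost
  everywhere on \<open>\<Omega>\<close>.
\<close>

definition L2_space :: "'a::euclidean_space set \<Rightarrow> ('a \<Rightarrow> real) set" where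
  "L2_space \<Omega> = {f \<in> borel_measurable (lebesgue_on \<Omega>). integrable (lebesgue_on \<Omega>) (\<lambda>x. (f x)\<^sup>2)}"

definition L2_inner :: "'a::euclidean_space set \<Rightarrow> ('a \<Rightarrow> real) \<Rightarrow> ('a \<Rightarrow> real) \<Rightarrow> real" where
  "L2_inner \<Omega> f g = (LINT x|lebesgue_on \<Omega>. f x * g x)"

definition L2_norm :: "'a::euclidean_space set \<Rightarrow> ('a \<Rightarrow> real) \<Rightarrow> real" where
  "L2_norm \<Omega> f = sqrt (L2_inner \<Omega> f f)"

definition interaction_function :: "'a::euclidean_space set \<Rightarrow> ('a \<Rightarrow> 'a \<Rightarrow> real) \<Rightarrow> bool" where
  "interaction_function \<Omega> \<sigma> \<longleftrightarrow>
     (\<lambda>(x, x'). \<sigma> x x') \<in> borel_measurable (lebesgue_on (\<Omega> \<times> \<Omega>)) \<and>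
     esssup (lebesgue_on (\<Omega> \<times> \<Omega>)) (\<lambda>(x, x'). ereal \<bar>\<sigma> x x'\<bar>) < \<infinity> \<and>
     (AE (x, x') in lebesgue_on (\<Omega> \<times> \<Omega>). \<sigma> x x' \<ge> 0)"

definition interaction_operator ::
    "'a::euclidean_space set \<Rightarrow> ('a \<Rightarrow> 'a \<Rightarrow> real) \<Rightarrow> ('a \<Rightarrow> real) \<Rightarrow> 'a \<Rightarrow> real" where
  "interaction_operator \<Omega> \<sigma> z = (\<lambda>x. LINT x'|lebesgue_on \<Omega>. \<sigma> x x' * (z x' - z x))"

text \<open>\<open>adjoint_value \<Omega> \<sigma> v w\<close> says that \<open>A\<^sup>* v = w\<close> in \<open>L\<^sup>2(\<Omega>)\<close>.\<close>

definition adjoint_value ::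
    "'a::euclidean_space set \<Rightarrow> ('a \<Rightarrow> 'a \<Rightarrow> real) \<Rightarrow> ('a \<Rightarrow> real) \<Rightarrow> ('a \<Rightarrow> real) \<Rightarrow> bool" where
  "adjoint_value \<Omega> \<sigma> v w \<longleftrightarrow>
     v \<in> L2_space \<Omega> \<and> w \<in> L2_space \<Omega> \<and>
     (\<forall>z \<in> L2_space \<Omega>. L2_inner \<Omega> (interaction_operator \<Omega> \<sigma> z) v = L2_inner \<Omega> z w)"

definition total_influence :: "'a::euclidean_space set \<Rightarrow> ('a \<Rightarrow> 'a \<Rightarrow> real) \<Rightarrow> 'a \<Rightarrow> real" where
  "total_influence \<Omega> \<sigma> x = (LINT x'|lebesgue_on \<Omega>. \<sigma> x x')"

text \<open>The dual of \<^const>\<open>esssup\<close>: the supremum of all \<open>c\<close> with \<open>c \<le> f\<close> almost everywhere.\<close>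

definition essinf :: "'a measure \<Rightarrow> ('a \<Rightarrow> ereal) \<Rightarrow> ereal" where
  "essinf M f = Liminf (ae_filter M) f"

text \<open>The complement in \<open>\<Omega>\<close> of the largest open set on which \<open>f\<close> vanishes almost everywhere.\<close>

definition ess_support :: "'a::euclidean_space set \<Rightarrow> ('a \<Rightarrow> real) \<Rightarrow> 'a set" where
  "ess_support \<Omega> f = \<Omega> - \<Union>{U. open U \<and> (AE x in lebesgue_on \<Omega>. x \<in> U \<longrightarrow> f x = 0)}"

text \<open>
  The points \<open>x\<close> for which \<open>\<sigma>(x, \<cdot>)\<close> is defined almost everywhere.  A representative is a total
  function here, so this becomes the condition that the section is a measurable function.
  The condition is not automatic for a Lebesgue measurable \<open>\<sigma>\<close>; by Fubini it holds for almost
  every \<open>x\<close>.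
\<close>

definition graph_vertices :: "'a::euclidean_space set \<Rightarrow> ('a \<Rightarrow> 'a \<Rightarrow> real) \<Rightarrow> 'a set" where
  "graph_vertices \<Omega> \<sigma> = {x \<in> \<Omega>. \<sigma> x \<in> borel_measurable (lebesgue_on \<Omega>)}"

definition graph_strongly_connected_L2 ::
    "'a::euclidean_space set \<Rightarrow> ('a \<Rightarrow> 'a \<Rightarrow> real) \<Rightarrow> bool" where
  "graph_strongly_connected_L2 \<Omega> \<sigma> \<longleftrightarrow>
     strongly_connected_on (graph_vertices \<Omega> \<sigma>) (\<lambda>x x'. x' \<in> ess_support \<Omega> (\<sigma> x)) \<and>
     essinf (lebesgue_on \<Omega>) (\<lambda>x. ereal (total_influence \<Omega> \<sigma> x)) > 0"

definition positive_kernel_function ::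
    "'a::euclidean_space set \<Rightarrow> ('a \<Rightarrow> 'a \<Rightarrow> real) \<Rightarrow> ('a \<Rightarrow> real) \<Rightarrow> bool" where
  "positive_kernel_function \<Omega> \<sigma> v \<longleftrightarrow>
     adjoint_value \<Omega> \<sigma> v (\<lambda>_. 0) \<and>
     (AE x in lebesgue_on \<Omega>. v x > 0) \<and>
     L2_inner \<Omega> v (\<lambda>_. 1) = 1"

text \<open>
  \<open>v\<close> is the unique element of the kernel of \<open>A\<^sup>*\<close> in \<open>L\<^sup>2(\<Omega>)\<close> that is positive and normalized.
  Uniqueness is part of the notion: if \<open>\<Omega>\<close> is split into two measurable sets \<open>B\<close>, \<open>C\<close> that both
  meet every open ball contained in \<open>\<Omega>\<close> in positive measure, then
  \<open>\<sigma> = 1\<^bsub>B \<times> B\<^esub> + 1\<^bsub>C \<times> C\<^esub>\<close> is strongly connected, as every \<open>\<sigma>(x, \<cdot>)\<close> has full essential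
  support, and all normalized positive combinations of \<open>1\<^bsub>B\<^esub>\<close> and \<open>1\<^bsub>C\<^esub>\<close> lie in that kernel.
\<close>

definition weight_function ::
    "'a::euclidean_space set \<Rightarrow> ('a \<Rightarrow> 'a \<Rightarrow> real) \<Rightarrow> ('a \<Rightarrow> real) \<Rightarrow> bool" where
  "weight_function \<Omega> \<sigma> v \<longleftrightarrow>
     positive_kernel_function \<Omega> \<sigma> v \<and>
     (\<forall>w. positive_kernel_function \<Omega> \<sigma> w \<longrightarrow> (AE x in lebesgue_on \<Omega>. w x = v x))"

definition weighted_mean_L2 ::
    "'a::euclidean_space set \<Rightarrow> ('a \<Rightarrow> real) \<Rightarrow> ('a \<Rightarrow> real) \<Rightarrow> 'a \<Rightarrow> real" where
  "weighted_mean_L2 \<Omega> v z = (\<lambda>_. L2_inner \<Omega> z v)"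

text \<open>The equation is required to hold in \<open>L\<^sup>2(\<Omega>)\<close>, at \<open>t = 0\<close> with a one-sided derivative.\<close>

definition solves_consensus_L2 ::
    "'a::euclidean_space set \<Rightarrow> ('a \<Rightarrow> 'a \<Rightarrow> real) \<Rightarrow> (real \<Rightarrow> 'a \<Rightarrow> real) \<Rightarrow> bool" where
  "solves_consensus_L2 \<Omega> \<sigma> y \<longleftrightarrow>
     (\<forall>t\<ge>0. y t \<in> L2_space \<Omega> \<and>
        ((\<lambda>s. L2_norm \<Omega> (\<lambda>x. (y s x - y t x) / (s - t) - interaction_operator \<Omega> \<sigma> (y t) x))
           \<longlongrightarrow> 0) (at t within {0..}))"

end

theory Submission
  imports Defs "HOL-Probability.Probability" "HOL-Complex_Analysis.Great_Picard"
begin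

text \<open>
  Since \<open>A\<^sup>* v = 0\<close>, the weighted energy \<open>\<integral> v z\<^sup>2\<close> decays at the rate
  \<open>D(z) = \<integral>\<integral> v(x) \<sigma>(x, x') (z(x') - z(x))\<^sup>2\<close>.  In finite dimensions \<open>D\<close> is coercive on the
  hyperplane \<open>\<langle>z, v\<rangle> = 0\<close>, and this is enough.  In \<open>L\<^sup>2(\<Omega>)\<close> the weight \<open>v\<close> is bounded but may come
  arbitrarily close to \<open>0\<close>, so the weighted energy does not control the norm.  Instead,
  \<open>\<integral> (1 + 2 B v) z\<^sup>2\<close> is a Lyapunov function for large \<open>B\<close>, that is,
  \<open>\<langle>z, A z\<rangle> - B D(z) \<le> - c \<parallel>z\<parallel>\<^sup>2\<close> whenever \<open>\<langle>z, v\<rangle> = 0\<close>.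

  Suppose that no such \<open>B\<close>, \<open>c\<close> exist.  Then there are unit vectors \<open>z\<^sub>n\<close> with \<open>\<langle>z\<^sub>n, v\<rangle> = 0\<close>,
  \<open>D(z\<^sub>n) \<rightarrow> 0\<close> and \<open>\<langle>z\<^sub>n, A z\<^sub>n\<rangle> \<ge> - 1 / n\<close>.  Write \<open>A = K - S\<close>, where \<open>K\<close> is the integral operator
  with kernel \<open>\<sigma>\<close>.  Along a subsequence \<open>K z\<^sub>n\<close> converges pointwise to some \<open>g\<close>, and
  \<open>\<integral> v (A z\<^sub>n)\<^sup>2 \<le> C D(z\<^sub>n)\<close> forces \<open>z\<^sub>n \<rightarrow> g / S\<close> in the weighted norm.  Hence \<open>D(g / S) = 0\<close>, which
  by the uniqueness of \<open>v\<close> makes \<open>g / S\<close> constant, and therefore \<open>0\<close>.  So \<open>K z\<^sub>n \<rightarrow> 0\<close> in norm,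
  against \<open>\<delta> \<le> \<langle>z\<^sub>n, S z\<^sub>n\<rangle> = \<langle>z\<^sub>n, K z\<^sub>n\<rangle> - \<langle>z\<^sub>n, A z\<^sub>n\<rangle>\<close>.\<close>

section \<open>Gronwall estimate and induction along paths\<close>

text \<open>Gronwall: \<open>q t * exp (a * t)\<close> has nonpositive derivative. The derivative is
  one-sided at 0, so monotonicity is drawn from the open interval and continuity up to its
  ends.\<close>

lemma exponential_decay:
  fixes q :: "real \<Rightarrow> real"
  assumes "\<And>t. t \<ge> 0 \<Longrightarrow> (q has_real_derivative q' t) (at t within {0..})"
    and "\<And>t. t \<ge> 0 \<Longrightarrow> q' t \<le> - a * q t" and "t \<ge> 0"
  shows "q t \<le> q 0 * exp (- a * t)"
proof -
  have der: "((\<lambda>t. q t * exp (a * t)) has_real_derivative (q' s + a * q s) * exp (a * s)) (at s within {0..})"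
    if "s \<ge> 0" for s
    by (rule derivative_eq_intros assms(1)[OF that] refl | simp add: algebra_simps)+
  have "q t * exp (a * t) \<le> q 0 * exp (a * 0)"
  proof (rule DERIV_nonpos_imp_decreasing_open[OF assms(3)])
    fix s :: real assume s: "0 < s" "s < t"
    have "at s within {0..} = at s"
      using s by (intro at_within_interior) simp
    then show "\<exists>y. ((\<lambda>t. q t * exp (a * t)) has_real_derivative y) (at s) \<and> y \<le> 0"
      using der[of s] assms(2)[of s] s by (intro exI conjI) (auto intro!: mult_nonpos_nonneg)
  next
    show "continuous_on {0..t} (\<lambda>t. q t * exp (a * t))"
      by (rule continuous_on_subset[OF DERIV_continuous_on[OF der]]) auto
  qed
  then show ?thesis
    by (simp add: exp_minus field_simps)
qed

text \<open>A property inherited backwards along arcs travels from the last vertex of a path to the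
  first. Paths are supplied only for distinct endpoints, hence the case distinction.\<close>

lemma strongly_connected_onD:
  assumes "strongly_connected_on V E" "x \<in> V" "z \<in> V" "P z"
    and step: "\<And>x y. E x y \<Longrightarrow> P y \<Longrightarrow> P x"
  shows "P x"
proof (cases "x = z")
  case False
  then obtain p where p: "length p \<ge> 2" "hd p = x" "last p = z" "successively E p"
    using assms unfolding strongly_connected_on_def by blast
  have "P (hd p)" if "p \<noteq> []" "successively E p" "P (last p)" for p
    using that by (induction p rule: induct_list012) (auto intro: step)
  from this[of p] show ?thesis
    using p assms(4) by fastforce
qed (use assms in simp)

section \<open>Finite-dimensional case\<close>

lemma interaction_matrix_vec:
  "(interaction_matrix \<sigma> *v y) $ i = (\<Sum>j\<in>UNIV. \<sigma> $ i $ j * (y $ j - y $ i))"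
proof -
  have "(interaction_matrix \<sigma> *v y) $ i
      = (\<Sum>j\<in>UNIV - {i}. \<sigma> $ i $ j * y $ j) - (\<Sum>k\<in>UNIV - {i}. \<sigma> $ i $ k) * y $ i"
    by (simp add: matrix_vector_mult_def interaction_matrix_def sum.remove[of UNIV i])
  also have "\<dots> = (\<Sum>j\<in>UNIV - {i}. \<sigma> $ i $ j * (y $ j - y $ i))"
    by (simp add: sum_distrib_left sum_distrib_right sum_subtractf algebra_simps)
  also have "\<dots> = (\<Sum>j\<in>UNIV. \<sigma> $ i $ j * (y $ j - y $ i))"
    by (simp add: sum.remove[of UNIV i])
  finally show ?thesis .
qed

text \<open>The diagonal entry of \<sigma> contributes the same term to both sums, so they may run
  over all indices.\<close>

lemma transpose_interaction_matrix_vec: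
  "(transpose (interaction_matrix \<sigma>) *v w) $ j
     = (\<Sum>i\<in>UNIV. \<sigma> $ i $ j * w $ i) - (\<Sum>i\<in>UNIV. \<sigma> $ j $ i) * w $ j"
proof -
  have "(transpose (interaction_matrix \<sigma>) *v w) $ j
      = (\<Sum>i\<in>UNIV - {j}. \<sigma> $ i $ j * w $ i) - (\<Sum>k\<in>UNIV - {j}. \<sigma> $ j $ k) * w $ j"
    by (simp add: matrix_vector_mult_def transpose_def interaction_matrix_def sum.remove[of UNIV j])
  then show ?thesis
    by (simp add: sum.remove[of UNIV j] algebra_simps)
qed

context
  fixes \<sigma> :: "real^'n^'n"
  assumes nonneg: "\<And>i j. \<sigma> $ i $ j \<ge> 0"
    and connected: "graph_strongly_connected \<sigma>"
begin

section \<open>Perron-Frobenius argument for the weight vector\<close>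

lemma path_closed:
  assumes "P j" "\<And>i j. \<sigma> $ i $ j > 0 \<Longrightarrow> P j \<Longrightarrow> P i"
  shows "P i"
  using strongly_connected_onD[of UNIV _ i j P] connected assms
  unfolding graph_strongly_connected_def by blast

text \<open>The triangle inequality makes every defect \<open>h j\<close> nonnegative. Exchanging
  the order of summation shows that the defects add up to 0, so each of them vanishes.\<close>

lemma adjoint_kernel_abs:
  assumes w: "transpose (interaction_matrix \<sigma>) *v w = 0"
  shows "transpose (interaction_matrix \<sigma>) *v (\<chi> i. \<bar>w $ i\<bar>) = 0"
proof -
  define S where "S j = (\<Sum>i\<in>UNIV. \<sigma> $ j $ i)" for j
  have S: "S j \<ge> 0" for j
    by (simp add: S_def sum_nonneg nonneg)
  have eq: "S j * w $ j = (\<Sum>i\<in>UNIV. \<sigma> $ i $ j * w $ i)" for j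
    using transpose_interaction_matrix_vec[of \<sigma> w j] w by (simp add: S_def)
  define h where "h j = (\<Sum>i\<in>UNIV. \<sigma> $ i $ j * \<bar>w $ i\<bar>) - S j * \<bar>w $ j\<bar>" for j
  have h: "h j \<ge> 0" for j
  proof -
    have "S j * \<bar>w $ j\<bar> = \<bar>\<Sum>i\<in>UNIV. \<sigma> $ i $ j * w $ i\<bar>"
      using S[of j] by (simp add: eq[symmetric] abs_mult)
    also have "\<dots> \<le> (\<Sum>i\<in>UNIV. \<sigma> $ i $ j * \<bar>w $ i\<bar>)"
      by (rule order_trans[OF sum_abs]) (simp add: abs_mult nonneg)
    finally show ?thesis by (simp add: h_def)
  qed
  have "(\<Sum>j\<in>UNIV. \<Sum>i\<in>UNIV. \<sigma> $ i $ j * \<bar>w $ i\<bar>) = (\<Sum>j\<in>UNIV. S j * \<bar>w $ j\<bar>)"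
    by (subst sum.swap) (simp add: S_def sum_distrib_right)
  then have "(\<Sum>j\<in>UNIV. h j) = 0"
    by (simp add: h_def sum_subtractf)
  then have "h j = 0" for j
    using h by (simp add: sum_nonneg_eq_0_iff)
  then show ?thesis
    unfolding vec_eq_iff transpose_interaction_matrix_vec by (simp add: h_def S_def)
qed

text \<open>By \<open>adjoint_kernel_abs\<close> the absolute values solve the same equation. At a
  zero of w it equates a sum of nonnegative terms to 0, so w vanishes at every vertex with an arc
  into that zero, and by connectivity everywhere.\<close>

lemma adjoint_kernel_zero_or_nonvanishing:
  assumes w: "transpose (interaction_matrix \<sigma>) *v w = 0" and "w $ j = 0"
  shows "w = 0"
proof -
  have "w $ i = 0" for i
  proof (rule path_closed[of "\<lambda>i. w $ i = 0" j])
    fix i j assume "\<sigma> $ i $ j > 0" "w $ j = 0"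
    then have "(\<Sum>i\<in>UNIV. \<sigma> $ i $ j * \<bar>w $ i\<bar>) = 0"
      using transpose_interaction_matrix_vec[of \<sigma> "\<chi> i. \<bar>w $ i\<bar>" j] adjoint_kernel_abs[OF w]
      by simp
    then have "\<sigma> $ i $ j * \<bar>w $ i\<bar> = 0"
      by (subst (asm) sum_nonneg_eq_0_iff) (auto simp: nonneg)
    then show "w $ i = 0"
      using \<open>\<sigma> $ i $ j > 0\<close> by simp
  qed (fact assms)
  then show ?thesis
    by (simp add: vec_eq_iff)
qed

text \<open>Since e lies in the kernel of A, the transpose is singular too. The absolute values of
  any nonzero vector in its kernel, divided by their sum, give v.\<close>

lemma weight_vector_ex1:
  "\<exists>!v. transpose (interaction_matrix \<sigma>) *v v = 0 \<and> (\<forall>i. v $ i > 0) \<and> v \<bullet> vec 1 = 1"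
proof -
  let ?A = "interaction_matrix \<sigma>"
  have "?A *v vec 1 = 0"
    by (simp add: vec_eq_iff interaction_matrix_vec)
  moreover have "(vec 1 :: real^'n) \<noteq> 0"
    by (simp add: vec_eq_iff)
  ultimately have "\<not> invertible ?A"
    using matrix_left_invertible_ker[of ?A] by (auto simp: invertible_def)
  then have "\<not> invertible (transpose ?A)"
    by (simp add: invertible_det_nz)
  then obtain w where w: "transpose ?A *v w = 0" "w \<noteq> 0"
    using invertible_left_inverse matrix_left_invertible_ker by blast
  define c where "c = (\<Sum>i\<in>UNIV. \<bar>w $ i\<bar>)"
  define v where "v = (1 / c) *\<^sub>R (\<chi> i. \<bar>w $ i\<bar>)"
  have pos: "\<bar>w $ i\<bar> > 0" for i
    using adjoint_kernel_zero_or_nonvanishing[OF w(1)] w(2) by auto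
  have c: "c > 0"
    unfolding c_def by (intro sum_pos) (use pos in auto)
  have v: "transpose ?A *v v = 0" "v $ i > 0" "v \<bullet> vec 1 = 1" for i
  proof -
    show "transpose ?A *v v = 0"
      unfolding v_def by (simp only: matrix_vector_mult_scaleR adjoint_kernel_abs[OF w(1)]) simp
    show "v $ i > 0"
      using c pos by (simp add: v_def)
    show "v \<bullet> vec 1 = 1"
      using c by (simp add: v_def inner_vec_def c_def flip: sum_divide_distrib)
  qed
  show ?thesis
  proof (rule ex1I[of _ v])
    fix u :: "real^'n"
    assume "transpose ?A *v u = 0 \<and> (\<forall>i. u $ i > 0) \<and> u \<bullet> vec 1 = 1"
    then have u: "transpose ?A *v u = 0" "\<forall>i. u $ i > 0" "u \<bullet> vec 1 = 1" by auto
    obtain i :: 'n where True by simp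
    \<comment> \<open>With this \<open>d\<close> the kernel element \<open>u - d *\<^sub>R v\<close>
      vanishes at \<open>i\<close>, hence altogether; the normalization then gives
      \<open>d = 1\<close>.\<close>
    define d where "d = u $ i / v $ i"
    have "u - d *\<^sub>R v = 0"
    proof (rule adjoint_kernel_zero_or_nonvanishing)
      show "transpose ?A *v (u - d *\<^sub>R v) = 0"
        by (simp only: matrix_vector_mult_diff_distrib matrix_vector_mult_scaleR u v) simp
      show "(u - d *\<^sub>R v) $ i = 0"
        using v(2)[of i] by (simp add: d_def)
    qed
    then have "u = d *\<^sub>R v" by simp
    with u(3) v(3) show "u = v" by simp
  qed (use v in blast)
qed

lemmas weight_vector = theI'[OF weight_vector_ex1, folded weight_vector_def]

section \<open>Dissipation and its coercivity\<close>

text \<open>The Dirichlet form of the graph weighted by v. It is the rate at which the sum of v_i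
  z_i^2 decreases along the flow.\<close>

definition matrix_dissipation :: "real^'n \<Rightarrow> real" where
  "matrix_dissipation z = (\<Sum>i\<in>UNIV. \<Sum>j\<in>UNIV. weight_vector \<sigma> $ i * \<sigma> $ i $ j * (z $ j - z $ i)\<^sup>2)"

text \<open>Use 2 z_i (z_j - z_i) = z_j^2 - z_i^2 - (z_j - z_i)^2. The differences of squares cancel
  in the weighted sum because v is in the kernel of the transpose.\<close>

lemma matrix_energy_identity:
  "2 * (\<Sum>i\<in>UNIV. weight_vector \<sigma> $ i * z $ i * (interaction_matrix \<sigma> *v z) $ i) = - matrix_dissipation z"
proof -
  let ?v = "weight_vector \<sigma>"
  have ker: "(\<Sum>i\<in>UNIV. \<sigma> $ i $ j * ?v $ i) = (\<Sum>i\<in>UNIV. \<sigma> $ j $ i) * ?v $ j" for j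
    using transpose_interaction_matrix_vec[of \<sigma> ?v j] weight_vector by simp
  have "(\<Sum>i\<in>UNIV. \<Sum>j\<in>UNIV. ?v $ i * \<sigma> $ i $ j * (z $ j)\<^sup>2)
      = (\<Sum>j\<in>UNIV. (\<Sum>i\<in>UNIV. \<sigma> $ i $ j * ?v $ i) * (z $ j)\<^sup>2)"
    by (subst sum.swap) (simp add: sum_distrib_left sum_distrib_right mult_ac)
  also have "\<dots> = (\<Sum>i\<in>UNIV. \<Sum>j\<in>UNIV. ?v $ i * \<sigma> $ i $ j * (z $ i)\<^sup>2)"
    unfolding ker by (simp add: sum_distrib_left sum_distrib_right mult_ac)
  finally have "(\<Sum>i\<in>UNIV. \<Sum>j\<in>UNIV. ?v $ i * \<sigma> $ i $ j * ((z $ j)\<^sup>2 - (z $ i)\<^sup>2)) = 0"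
    by (simp add: sum_subtractf right_diff_distrib)
  moreover have "2 * (\<Sum>i\<in>UNIV. ?v $ i * z $ i * (interaction_matrix \<sigma> *v z) $ i) + matrix_dissipation z
      = (\<Sum>i\<in>UNIV. \<Sum>j\<in>UNIV. ?v $ i * \<sigma> $ i $ j * ((z $ j)\<^sup>2 - (z $ i)\<^sup>2))"
    unfolding matrix_dissipation_def interaction_matrix_vec
    by (simp add: sum_distrib_left flip: sum.distrib)
       (intro sum.cong refl, simp add: power2_eq_square algebra_simps)
  ultimately show ?thesis by simp
qed

text \<open>As v is positive, z agrees at the two ends of each arc and is constant by connectivity.
  A constant of weighted mean 0 is 0, since v has mass 1.\<close>

lemma matrix_dissipation_eq_0D:
  assumes "matrix_dissipation z = 0" "z \<bullet> weight_vector \<sigma> = 0"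
  shows "z = 0"
proof -
  have v: "weight_vector \<sigma> $ i > 0" for i
    using weight_vector by blast
  have nn: "0 \<le> weight_vector \<sigma> $ i * \<sigma> $ i $ j * (z $ j - z $ i)\<^sup>2" for i j
    using v[of i] nonneg[of i j] by simp
  have "(\<Sum>j\<in>UNIV. weight_vector \<sigma> $ i * \<sigma> $ i $ j * (z $ j - z $ i)\<^sup>2) = 0" for i
    using assms(1) unfolding matrix_dissipation_def
    by (subst (asm) sum_nonneg_eq_0_iff) (auto intro!: sum_nonneg nn)
  then have term0: "weight_vector \<sigma> $ i * \<sigma> $ i $ j * (z $ j - z $ i)\<^sup>2 = 0" for i j
    by (subst (asm) sum_nonneg_eq_0_iff) (auto intro!: nn)
  obtain k :: 'n where True by simp
  have "z $ i = z $ k" for i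
  proof (rule path_closed[of "\<lambda>i. z $ i = z $ k" k])
    fix i j assume "\<sigma> $ i $ j > 0" "z $ j = z $ k"
    then show "z $ i = z $ k" using term0[of i j] v[of i] by simp
  qed simp
  then have z: "z = (z $ k) *\<^sub>R vec 1"
    by (simp add: vec_eq_iff)
  have "z \<bullet> weight_vector \<sigma> = z $ k * (weight_vector \<sigma> \<bullet> vec 1)"
    by (subst z) (simp add: inner_commute)
  then show "z = 0"
    using assms(2) z weight_vector by simp
qed

text \<open>A positive continuous function on the compact unit sphere of the hyperplane has a
  positive minimum; homogeneity of degree 2 extends the bound to all z.\<close>

lemma matrix_dissipation_coercive:
  obtains c where "c > 0" "\<And>z. z \<bullet> weight_vector \<sigma> = 0 \<Longrightarrow> matrix_dissipation z \<ge> c * (norm z)\<^sup>2"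
proof -
  let ?K = "sphere 0 1 \<inter> {z. z \<bullet> weight_vector \<sigma> = 0}"
  have v: "weight_vector \<sigma> $ i > 0" for i
    using weight_vector by blast
  have nn: "matrix_dissipation z \<ge> 0" for z
    unfolding matrix_dissipation_def using v nonneg by (intro sum_nonneg mult_nonneg_nonneg) (auto intro: less_imp_le)
  have cont: "continuous_on ?K matrix_dissipation"
    unfolding matrix_dissipation_def by (intro continuous_intros)
  have comp: "compact ?K"
    by (intro compact_Int_closed closed_hyperplane[of "weight_vector \<sigma>" 0, simplified inner_commute]) auto
  have "\<exists>c>0. \<forall>z\<in>?K. matrix_dissipation z \<ge> c"
  \<comment> \<open>For N = 1 the slice is empty and any positive constant serves.\<close>
  proof (cases "?K = {}")
    case False
    from continuous_attains_inf[OF comp this cont] obtain z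
      where z: "z \<in> ?K" "\<And>w. w \<in> ?K \<Longrightarrow> matrix_dissipation z \<le> matrix_dissipation w" by blast
    have "matrix_dissipation z \<noteq> 0"
      using matrix_dissipation_eq_0D[of z] z(1) by auto
    then show ?thesis
      using nn[of z] z(2) by (intro exI[of _ "matrix_dissipation z"]) auto
  qed (use zero_less_one in blast)
  then obtain c where c: "c > 0" "\<And>z. z \<in> ?K \<Longrightarrow> matrix_dissipation z \<ge> c" by blast
  show ?thesis
  proof
    fix z assume z: "z \<bullet> weight_vector \<sigma> = 0"
    show "matrix_dissipation z \<ge> c * (norm z)\<^sup>2"
    proof (cases "z = 0")
      case False
      define u where "u = (1 / norm z) *\<^sub>R z"
      have "u \<in> ?K" using False z by (simp add: u_def)
      moreover have "matrix_dissipation z = (norm z)\<^sup>2 * matrix_dissipation u"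
        unfolding matrix_dissipation_def sum_distrib_left
      proof (intro sum.cong refl)
        fix i j
        have "z $ j - z $ i = norm z * (u $ j - u $ i)"
          using False by (simp add: u_def field_simps)
        then show "weight_vector \<sigma> $ i * \<sigma> $ i $ j * (z $ j - z $ i)\<^sup>2
          = (norm z)\<^sup>2 * (weight_vector \<sigma> $ i * \<sigma> $ i $ j * (u $ j - u $ i)\<^sup>2)"
          by (simp add: power_mult_distrib)
      qed
      ultimately show ?thesis
        using c(2)[of u] by (simp add: mult.commute mult_right_mono)
    qed (use nn in simp)
  qed fact
qed

text \<open>The weighted energy \<open>q\<close> lies between m |z|^2 and |z|^2, so coercivity gives
  q' \<le> - c q. Square roots halve the rate and produce the factor
  \<open>sqrt (1 / m)\<close>.\<close>

theorem consensus_exponential_decay: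
  obtains \<rho> M where "\<rho> > 0" "M > 0"
    "\<And>y t. solves_consensus \<sigma> y \<Longrightarrow> t \<ge> 0 \<Longrightarrow>
       norm (y t - weighted_mean (weight_vector \<sigma>) (y t))
         \<le> M * norm (y 0 - weighted_mean (weight_vector \<sigma>) (y t)) * exp (- \<rho> * t)"
proof -
  let ?v = "weight_vector \<sigma>" and ?A = "interaction_matrix \<sigma>"
  obtain c where c: "c > 0" "\<And>z. z \<bullet> ?v = 0 \<Longrightarrow> matrix_dissipation z \<ge> c * (norm z)\<^sup>2"
    using matrix_dissipation_coercive by blast
  have v: "?v $ i > 0" for i
    using weight_vector by blast
  have v1: "(\<Sum>i\<in>UNIV. ?v $ i) = 1"
    using weight_vector by (simp add: inner_vec_def)
  have v_le: "?v $ i \<le> 1" for i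
    using member_le_sum[of i UNIV "\<lambda>i. ?v $ i"] v v1 by (simp add: less_imp_le)
  define m where "m = Min (range (\<lambda>i. ?v $ i))"
  have m: "m > 0" "m \<le> ?v $ i" for i
    using v by (simp_all add: m_def)
  define q where "q z = (\<Sum>i\<in>UNIV. ?v $ i * (z $ i)\<^sup>2)" for z
  have norm2: "(norm z)\<^sup>2 = (\<Sum>i\<in>UNIV. (z $ i)\<^sup>2)" for z :: "real^'n"
    by (simp add: norm_vec_def L2_set_def sum_nonneg)
  have q_upper: "q z \<le> (norm z)\<^sup>2" for z
    unfolding q_def norm2 by (intro sum_mono mult_left_le_one_le) (use v v_le less_imp_le in auto)
  have q_lower: "m * (norm z)\<^sup>2 \<le> q z" for z
    unfolding q_def norm2 sum_distrib_left by (intro sum_mono mult_right_mono m) auto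
  show ?thesis
  proof
    show "c / 2 > 0" "sqrt (1 / m) > 0" using c m by auto
    fix y :: "real \<Rightarrow> real^'n" and t :: real
    assume y: "solves_consensus \<sigma> y" and t: "t \<ge> 0"
    have der: "(y has_vector_derivative (?A *v y s)) (at s within {0..})" if "s \<ge> 0" for s
      using y that by (auto simp: solves_consensus_def)
    have inner_A: "(?A *v x) \<bullet> ?v = 0" for x
      using weight_vector by (metis dot_lmul_matrix inner_commute inner_zero_left transpose_matrix_vector)
    \<comment> \<open>By conservation, the deviation can be formed with the mean at time 0 and the
      result stated with the mean at time t.\<close>
    have mean: "y s \<bullet> ?v = y 0 \<bullet> ?v" if "s \<ge> 0" for s
    proof -
      have "((\<lambda>s. y s \<bullet> ?v) has_derivative (\<lambda>h. 0)) (at s within {0..})" if "s \<in> {0..}" for s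
        using has_derivative_inner_left[OF der[of s, unfolded has_vector_derivative_def], of ?v] that
        by (simp add: inner_A)
      from has_derivative_zero_unique[OF _ this, of 0] that show ?thesis by auto
    qed
    define z where "z s = y s - weighted_mean ?v (y 0)" for s
    have A1: "?A *v weighted_mean ?v x = 0" for x
      by (simp add: vec_eq_iff interaction_matrix_vec weighted_mean_def)
    have z_der: "(z has_vector_derivative (?A *v z s)) (at s within {0..})" if "s \<ge> 0" for s
      unfolding z_def using der[OF that]
      by (auto intro!: derivative_eq_intros simp: matrix_vector_mult_diff_distrib A1)
    have z_mean: "z s \<bullet> ?v = 0" if "s \<ge> 0" for s
      using mean[OF that] weight_vector
      by (simp add: z_def weighted_mean_def inner_diff_right inner_commute)
    have q_der: "((\<lambda>s. q (z s)) has_real_derivative - matrix_dissipation (z s)) (at s within {0..})"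
      if "s \<ge> 0" for s
    proof -
      have "((\<lambda>s. z s $ i) has_real_derivative (?A *v z s) $ i) (at s within {0..})" for i
        using bounded_linear.has_vector_derivative[OF bounded_linear_vec_nth z_der[OF that]]
        by (simp add: has_real_derivative_iff_has_vector_derivative)
      then have "((\<lambda>s. q (z s)) has_real_derivative
          (\<Sum>i\<in>UNIV. ?v $ i * (2 * z s $ i * (?A *v z s) $ i))) (at s within {0..})"
        unfolding q_def by (auto intro!: derivative_eq_intros sum.cong)
      then show ?thesis
        by (simp add: matrix_energy_identity[symmetric] sum_distrib_left mult_ac)
    qed
    have "q (z t) \<le> q (z 0) * exp (- c * t)"
    proof (rule exponential_decay[OF q_der _ t])
      fix s :: real assume s: "s \<ge> 0"
      have "c * q (z s) \<le> c * (norm (z s))\<^sup>2"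
        using q_upper c(1) by simp
      also have "\<dots> \<le> matrix_dissipation (z s)"
        by (rule c(2)[OF z_mean[OF s]])
      finally show "- matrix_dissipation (z s) \<le> - c * q (z s)" by simp
    qed simp_all
    then have "m * (norm (z t))\<^sup>2 \<le> (norm (z 0))\<^sup>2 * exp (- c * t)"
      using q_lower[of "z t"] mult_right_mono[OF q_upper[of "z 0"], of "exp (- c * t)"]
      by (meson exp_ge_zero order_trans)
    then have "(norm (z t))\<^sup>2 \<le> (sqrt (1 / m) * norm (z 0) * exp (- (c / 2) * t))\<^sup>2"
      using m(1) by (simp add: power_mult_distrib field_simps flip: exp_of_nat_mult)
    then have "norm (z t) \<le> sqrt (1 / m) * norm (z 0) * exp (- (c / 2) * t)"
      by (rule power2_le_imp_le) (use m in auto)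
    then show "norm (y t - weighted_mean ?v (y t))
         \<le> sqrt (1 / m) * norm (y 0 - weighted_mean ?v (y t)) * exp (- (c / 2) * t)"
      using mean[OF t] by (simp add: z_def weighted_mean_def)
  qed
qed

end

section \<open>Square-integrable functions\<close>

text \<open>The condition of \<open>L2_space\<close> over an arbitrary measure, so that the spectral
  argument can run on an abstract probability space.\<close>

definition square_integrable :: "'a measure \<Rightarrow> ('a \<Rightarrow> real) \<Rightarrow> bool" where
  "square_integrable M f \<longleftrightarrow> f \<in> borel_measurable M \<and> integrable M (\<lambda>x. (f x)\<^sup>2)"

lemma square_integrable_measurable [measurable_dest]:
  "square_integrable M f \<Longrightarrow> f \<in> borel_measurable M"
  by (simp add: square_integrable_def)

lemma square_integrable_power2: "square_integrable M f \<Longrightarrow> integrable M (\<lambda>x. (f x)\<^sup>2)"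
  by (simp add: square_integrable_def)

lemma square_integrable_mult:
  assumes [measurable]: "square_integrable M f" "square_integrable M g"
  shows "integrable M (\<lambda>x. f x * g x)"
proof (rule Bochner_Integration.integrable_bound)
  show "integrable M (\<lambda>x. (f x)\<^sup>2 + (g x)\<^sup>2)"
    using assms by (simp add: square_integrable_def)
  have "\<bar>f x * g x\<bar> \<le> (f x)\<^sup>2 + (g x)\<^sup>2" for x
    using sum_squares_bound[of "\<bar>f x\<bar>" "\<bar>g x\<bar>"] zero_le_power2[of "f x"] zero_le_power2[of "g x"]
    unfolding abs_mult power2_abs by linarith
  then show "AE x in M. norm (f x * g x) \<le> norm ((f x)\<^sup>2 + (g x)\<^sup>2)"
    by simp
qed measurable

lemma square_integrable_add:
  assumes [measurable]: "square_integrable M f" "square_integrable M g"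
  shows "square_integrable M (\<lambda>x. f x + g x)"
  using square_integrable_mult[OF assms] assms
  by (simp add: square_integrable_def power2_sum mult.assoc)

lemma square_integrable_cmult:
  "square_integrable M f \<Longrightarrow> square_integrable M (\<lambda>x. c * f x)"
  by (auto simp: square_integrable_def power_mult_distrib intro: borel_measurable_times)

lemma square_integrable_diff:
  assumes "square_integrable M f" "square_integrable M g"
  shows "square_integrable M (\<lambda>x. f x - g x)"
  using square_integrable_add[OF assms(1) square_integrable_cmult[OF assms(2), of "-1"]] by simp

lemma square_integrable_bounded_mult:
  assumes [measurable]: "square_integrable M f" "g \<in> borel_measurable M"
    and b: "AE x in M. \<bar>g x\<bar> \<le> B"
  shows "square_integrable M (\<lambda>x. g x * f x)"
  unfolding square_integrable_def
proof safe
  show "integrable M (\<lambda>x. (g x * f x)\<^sup>2)"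
  proof (rule Bochner_Integration.integrable_bound)
    show "integrable M (\<lambda>x. B\<^sup>2 * (f x)\<^sup>2)"
      using assms by (simp add: square_integrable_def)
    show "AE x in M. norm ((g x * f x)\<^sup>2) \<le> norm (B\<^sup>2 * (f x)\<^sup>2)"
      using b
    proof eventually_elim
      case (elim x)
      then have "(g x)\<^sup>2 \<le> B\<^sup>2" by (rule abs_le_square_iff[THEN iffD1, OF order_trans[OF _ abs_ge_self]])
      then show ?case by (simp add: power_mult_distrib mult_right_mono)
    qed
  qed measurable
qed measurable

lemma (in finite_measure) square_integrable_bounded:
  assumes "f \<in> borel_measurable M" "AE x in M. \<bar>f x\<bar> \<le> B"
  shows "square_integrable M f"
  using square_integrable_bounded_mult[of M "\<lambda>_. 1" f B] assms
  by (simp add: square_integrable_def)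

lemma (in finite_measure) square_integrable_integrable:
  "square_integrable M f \<Longrightarrow> integrable M f"
  by (simp add: square_integrable_def square_integrable_imp_integrable)

lemma square_integrable_cong_AE:
  assumes "square_integrable M f" "g \<in> borel_measurable M" "AE x in M. f x = g x"
  shows "square_integrable M g"
proof -
  have "integrable M (\<lambda>x. (f x)\<^sup>2) \<longleftrightarrow> integrable M (\<lambda>x. (g x)\<^sup>2)"
    using assms by (intro integrable_cong_AE) (auto simp: square_integrable_def)
  then show ?thesis
    using assms by (simp add: square_integrable_def)
qed

text \<open>The square integral of \<open>s * f + t * g\<close> is a nonnegative quadratic form in
  (s, t); suitable values turn this into the discriminant inequality.\<close>

lemma Cauchy_Schwarz_integral:
  assumes f: "square_integrable M f" and g: "square_integrable M g"
  shows "(\<integral>x. f x * g x \<partial>M)\<^sup>2 \<le> (\<integral>x. (f x)\<^sup>2 \<partial>M) * (\<integral>x. (g x)\<^sup>2 \<partial>M)"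
proof -
  define a b c where "a = (\<integral>x. (f x)\<^sup>2 \<partial>M)" "b = (\<integral>x. f x * g x \<partial>M)" "c = (\<integral>x. (g x)\<^sup>2 \<partial>M)"
  note abc = this
  have q: "0 \<le> a * s\<^sup>2 + 2 * b * s * t + c * t\<^sup>2" for s t
  proof -
    have "0 \<le> (\<integral>x. (s * f x + t * g x)\<^sup>2 \<partial>M)" by simp
    also have "(\<integral>x. (s * f x + t * g x)\<^sup>2 \<partial>M)
        = (\<integral>x. s\<^sup>2 * (f x)\<^sup>2 + (2 * s * t) * (f x * g x) + t\<^sup>2 * (g x)\<^sup>2 \<partial>M)"
      by (intro Bochner_Integration.integral_cong refl) (simp add: power2_eq_square algebra_simps)
    also have "\<dots> = a * s\<^sup>2 + 2 * b * s * t + c * t\<^sup>2"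
      using square_integrable_power2[OF f] square_integrable_power2[OF g] square_integrable_mult[OF f g]
      by (simp add: abc)
    finally show ?thesis .
  qed
  have a: "a \<ge> 0" and c: "c \<ge> 0" by (simp_all add: abc)
  show ?thesis
    unfolding abc[symmetric]
  proof (cases "c = 0")
    case True
    have "b = 0"
    proof (rule ccontr)
      assume "b \<noteq> 0"
      \<comment> \<open>With \<open>c = 0\<close> this choice of t gives
        \<open>a + 2 * b * t = - 1\<close>.\<close>
      then show False
        using q[of 1 "- (a + 1) / (2 * b)"] True a by (simp add: field_simps)
    qed
    then show "b\<^sup>2 \<le> a * c" using True by simp
  next
    case False
    with c have "c > 0" by simp
    have "0 \<le> c * (a * c - b\<^sup>2)"
      using q[of c "- b"] by (simp add: power2_eq_square algebra_simps)
    with \<open>c > 0\<close> show "b\<^sup>2 \<le> a * c"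
      by (simp add: zero_le_mult_iff)
  qed
qed

lemma (in prob_space) square_integral_le:
  assumes f: "square_integrable M f"
  shows "(\<integral>x. \<bar>f x\<bar> \<partial>M)\<^sup>2 \<le> (\<integral>x. (f x)\<^sup>2 \<partial>M)"
proof -
  have "square_integrable M (\<lambda>x. \<bar>f x\<bar>)"
    using f by (auto simp: square_integrable_def)
  moreover have "square_integrable M (\<lambda>_. 1)"
    by (simp add: square_integrable_def)
  ultimately show ?thesis
    using Cauchy_Schwarz_integral[of M "\<lambda>x. \<bar>f x\<bar>" "\<lambda>_. 1"] by (simp add: prob_space)
qed

lemma L2_space_iff: "f \<in> L2_space \<Omega> \<longleftrightarrow> square_integrable (lebesgue_on \<Omega>) f"
  by (simp add: L2_space_def square_integrable_def)

section \<open>Weak sequential compactness\<close>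

text \<open>Enlarge a countable basis by its finite intersections, the empty one yielding
  \<open>UNIV\<close>. Countability serves a diagonal extraction, stability under intersections a
  Dynkin argument.\<close>

lemma countable_Int_stable_borel_generator:
  obtains G :: "'a::second_countable_topology set set"
  where "countable G" "Int_stable G" "borel = sigma UNIV G" "UNIV \<in> G"
proof -
  obtain B :: "'a set set" where B: "countable B" "topological_basis B"
    using ex_countable_basis by blast
  define G where "G = Inter ` {F. finite F \<and> F \<subseteq> B}"
  have "countable G"
    unfolding G_def using B by (intro countable_image countable_Collect_finite_subset)
  moreover have "Int_stable G"
    unfolding Int_stable_def
  proof safe
    fix a b assume "a \<in> G" "b \<in> G"
    then obtain A C where "finite A" "A \<subseteq> B" "a = \<Inter>A" "finite C" "C \<subseteq> B" "b = \<Inter>C"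
      by (auto simp: G_def)
    then have "finite (A \<union> C)" "A \<union> C \<subseteq> B" "a \<inter> b = \<Inter>(A \<union> C)"
      by auto
    then show "a \<inter> b \<in> G" unfolding G_def by blast
  qed
  moreover have "borel = sigma UNIV G"
  proof -
    have "sigma UNIV B = sigma UNIV G"
    proof (intro sigma_eqI sigma_sets_eqI)
      fix b assume "b \<in> B"
      then have "b \<in> G" by (auto simp: G_def intro!: image_eqI[of _ _ "{b}"])
      then show "b \<in> sigma_sets UNIV G" by (rule sigma_sets.Basic)
    next
      fix g assume "g \<in> G"
      then obtain F where F: "finite F" "F \<subseteq> B" "g = \<Inter>F" by (auto simp: G_def)
      have "\<Inter>F \<in> sets (sigma UNIV B)" if "finite F" "F \<subseteq> B" for F
        using that
      proof (induction F rule: finite_induct)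
        case empty
        then show ?case by (simp add: sigma_sets_top)
      next
        case (insert x F)
        then have "x \<in> sets (sigma UNIV B)" "\<Inter>F \<in> sets (sigma UNIV B)"
          by (auto intro: sigma_sets.Basic)
        then show ?case using sets.Int[of x "sigma UNIV B" "\<Inter>F"] by simp
      qed
      with F show "g \<in> sigma_sets UNIV B" by simp
    qed auto
    then show ?thesis using borel_eq_countable_basis[OF B] by simp
  qed
  moreover have "UNIV \<in> G"
    by (auto simp: G_def intro!: image_eqI[of _ _ "{}"])
  ultimately show ?thesis by (rule that)
qed

text \<open>Cauchy-Schwarz against an indicator. The bound is independent of z, so integrals over
  small sets are uniformly small.\<close>

lemma (in prob_space) abs_integral_indicator_le:
  assumes z: "square_integrable M z" "(\<integral>x. (z x)\<^sup>2 \<partial>M) \<le> 1" and A: "A \<in> sets M"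
  shows "\<bar>\<integral>x. indicator A x * z x \<partial>M\<bar> \<le> sqrt (prob A)"
proof -
  have i: "square_integrable M (indicator A)"
    using A by (intro square_integrable_bounded[of _ 1]) (auto simp: indicator_def)
  have sq: "(\<lambda>x. (indicator A x :: real)\<^sup>2) = indicator A"
    by (auto simp: indicator_def)
  have "(\<integral>x. indicator A x * z x \<partial>M)\<^sup>2 \<le> prob A * (\<integral>x. (z x)\<^sup>2 \<partial>M)"
    using Cauchy_Schwarz_integral[OF i z(1)] A sets.sets_into_space[OF A]
    by (simp add: sq Int_absorb2)
  also have "\<dots> \<le> prob A * 1"
    using z by (intro mult_left_mono) auto
  finally show ?thesis
    by (intro real_le_rsqrt) simp
qed

text \<open>
  The weak limit itself is never needed, so no representation theorem is involved: the sets \<open>A\<close> for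
  which \<open>\<integral>\<^bsub>A\<^esub> z\<^sub>n\<close> converges form a Dynkin system, because \<open>\<bar>\<integral>\<^bsub>A\<^esub> z\<^sub>n\<bar> \<le> sqrt (prob A)\<close>.
\<close>

lemma (in prob_space) weakly_Cauchy_subsequence:
  fixes z :: "nat \<Rightarrow> 'a \<Rightarrow> real" and \<phi> :: "'a \<Rightarrow> 'b::second_countable_topology"
  assumes \<phi> [measurable]: "\<phi> \<in> borel_measurable M"
    and z: "\<And>n. square_integrable M (z n)" "\<And>n. (\<integral>x. (z n x)\<^sup>2 \<partial>M) \<le> 1"
  obtains r where "strict_mono r"
    "\<forall>f\<in>borel_measurable borel. \<forall>B. (\<forall>x. \<bar>f x\<bar> \<le> B) \<longrightarrow>
       convergent (\<lambda>n. \<integral>x. f (\<phi> x) * z (r n) x \<partial>M)"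
proof -
  obtain G :: "'b set set" where G: "countable G" "Int_stable G" "borel = sigma UNIV G" "UNIV \<in> G"
    by (rule countable_Int_stable_borel_generator)
  have borelG: "sigma_sets UNIV G = sets borel"
    by (subst G(3)) simp
  \<comment> \<open>Only preimages of Borel sets under \<open>\<phi>\<close> are tested, since their
    sigma-algebra has a countable generator.\<close>
  define I where "I n A = (\<integral>x. indicator (\<phi> -` A \<inter> space M) x * z n x \<partial>M)" for n A
  have [measurable]: "z n \<in> borel_measurable M" for n
    using z by (simp add: square_integrable_def)
  have int: "integrable M (\<lambda>x. indicator (\<phi> -` A \<inter> space M) x * z n x)" if "A \<in> sets borel" for A n
    using integrable_mult_indicator[OF _ square_integrable_integrable[OF z(1)[of n]]]
      measurable_sets[OF \<phi> that] by simp
  have add: "I n (A \<union> B) = I n A + I n B" if "A \<in> sets borel" "B \<in> sets borel" "A \<inter> B = {}" for A B n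
  proof -
    have "I n (A \<union> B) = (\<integral>x. indicator (\<phi> -` A \<inter> space M) x * z n x
        + indicator (\<phi> -` B \<inter> space M) x * z n x \<partial>M)"
      unfolding I_def using that(3) by (intro Bochner_Integration.integral_cong refl) (auto simp: indicator_def)
    also have "\<dots> = I n A + I n B"
      unfolding I_def by (rule Bochner_Integration.integral_add[OF int[OF that(1)] int[OF that(2)]])
    finally show ?thesis .
  qed
  have bound: "\<bar>I n A\<bar> \<le> sqrt (prob (\<phi> -` A \<inter> space M))" if "A \<in> sets borel" for A n
    unfolding I_def using z measurable_sets[OF \<phi> that] by (intro abs_integral_indicator_le)
  have "norm (I n A) \<le> 1" if "A \<in> G" for n A
  proof -
    have "A \<in> sets borel" using borelG that by auto
    then show ?thesis
      using order_trans[OF bound, of A 1] by simp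
  qed
  \<comment> \<open>Diagonal extraction over the countable generator, on which the values are
    bounded by 1.\<close>
  then obtain r where r: "strict_mono r" "\<And>A. A \<in> G \<Longrightarrow> \<exists>l. (\<lambda>n. I (r n) A) \<longlonglongrightarrow> l"
    using function_convergent_subsequence[OF G(1), of I 1] by blast
  have "G \<subseteq> Pow UNIV" by simp
  have conv: "convergent (\<lambda>n. I (r n) A)" if "A \<in> sets borel" for A
    using G(2) \<open>G \<subseteq> Pow UNIV\<close> that[folded borelG]
  proof (induction rule: sigma_sets_induct_disjoint)
    case (basic A)
    with r show ?case by (auto simp: convergent_def)
  next
    case empty
    show ?case by (simp add: I_def convergent_const)
  next
    case (compl A)
    then have A: "A \<in> sets borel" using borelG by simp
    have "I n (UNIV - A) = I n UNIV - I n A" for n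
      using add[of A "UNIV - A" n] A by (simp add: Un_Diff_cancel)
    moreover have "convergent (\<lambda>n. I (r n) UNIV)"
      using r(2)[OF G(4)] by (auto simp: convergent_def)
    ultimately show ?case
      using compl by (simp add: convergent_diff)
  next
    case (union A)
    then have A: "A i \<in> sets borel" for i using borelG by auto
    have disj: "i = j" if "x \<in> A i" "x \<in> A j" for x i j
      using union(1) that unfolding disjoint_family_on_def by blast
    show ?case
    proof (rule Cauchy_convergent, rule CauchyI)
      fix e :: real assume e: "e > 0"
      \<comment> \<open>Split the union into its first k sets and the tail. Preimages of the tails
        decrease to the empty set, so some tail has integrals below \<open>e / 4\<close> uniformly
        in n, while the finite head is Cauchy up to \<open>e / 2\<close>.\<close>
      define T where "T k = (\<Union>i. A (i + k))" for k
      define H where "H k = (\<Union>i<k. A i)" for k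
      have meas: "T k \<in> sets borel" "H k \<in> sets borel" for k
        unfolding T_def H_def using A by auto
      have "(\<lambda>k. prob (\<phi> -` T k \<inter> space M)) \<longlonglongrightarrow> prob (\<Inter>k. \<phi> -` T k \<inter> space M)"
      proof (rule finite_Lim_measure_decseq)
        show "range (\<lambda>k. \<phi> -` T k \<inter> space M) \<subseteq> events"
          using measurable_sets[OF \<phi> meas(1)] by auto
        show "decseq (\<lambda>k. \<phi> -` T k \<inter> space M)"
        proof (rule decseq_SucI)
          fix n
          have "T (Suc n) \<subseteq> T n"
          proof
            fix x assume "x \<in> T (Suc n)"
            then obtain i where "x \<in> A (Suc i + n)" by (auto simp: T_def)
            then show "x \<in> T n" unfolding T_def by blast
          qed
          then show "\<phi> -` T (Suc n) \<inter> space M \<subseteq> \<phi> -` T n \<inter> space M" by auto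
        qed
      qed
      moreover have "(\<Inter>k. T k) = {}"
      proof (rule ccontr)
        assume "(\<Inter>k. T k) \<noteq> {}"
        then obtain x where x: "\<And>k. x \<in> T k" by auto
        from x[of 0] obtain i where i: "x \<in> A i" by (auto simp: T_def)
        from x[of "Suc i"] obtain j where "x \<in> A (j + Suc i)" by (auto simp: T_def)
        with i show False
          using disj[of x i "j + Suc i"] by simp
      qed
      then have "(\<Inter>k. \<phi> -` T k \<inter> space M) = {}" by auto
      ultimately have "(\<lambda>k. sqrt (prob (\<phi> -` T k \<inter> space M))) \<longlonglongrightarrow> sqrt 0"
        by (intro tendsto_real_sqrt) simp
      from LIMSEQ_D[OF this, of "e / 4"] e obtain k where
        k: "sqrt (prob (\<phi> -` T k \<inter> space M)) < e / 4" by auto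
      have split: "I n (\<Union>i. A i) = I n (H k) + I n (T k)" for n
      proof -
        have "(\<Union>i. A i) = H k \<union> T k"
        proof safe
          fix x i assume "x \<in> A i" "x \<notin> T k"
          have "i < k"
          proof (rule ccontr)
            assume "\<not> i < k"
            then have "x \<in> A ((i - k) + k)" using \<open>x \<in> A i\<close> by simp
            then show False using \<open>x \<notin> T k\<close> unfolding T_def by blast
          qed
          then show "x \<in> H k" using \<open>x \<in> A i\<close> by (auto simp: H_def)
        qed (auto simp: H_def T_def)
        moreover have "H k \<inter> T k = {}"
        proof (rule ccontr)
          assume "H k \<inter> T k \<noteq> {}"
          then obtain x i j where "x \<in> A i" "i < k" "x \<in> A (j + k)" by (auto simp: H_def T_def)
          then show False
            using disj[of x i "j + k"] by simp
        qed
        ultimately show ?thesis using add[OF meas(2) meas(1)] by simp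
      qed
      have H: "I n (H k) = (\<Sum>i<k. I n (A i))" for n k
      proof (induction k)
        case 0
        then show ?case by (simp add: H_def I_def)
      next
        case (Suc k)
        have "H (Suc k) = H k \<union> A k" by (auto simp: H_def lessThan_Suc)
        moreover have "H k \<inter> A k = {}"
          using disj by (auto simp: H_def)
        ultimately show ?case using add[OF meas(2) A] Suc by simp
      qed
      have "convergent (\<lambda>n. I (r n) (H k))"
        unfolding H by (intro convergent_sum union(3))
      then have "Cauchy (\<lambda>n. I (r n) (H k))" by (rule convergent_Cauchy)
      from CauchyD[OF this, of "e / 2"] e obtain N where
        N: "\<And>m n. m \<ge> N \<Longrightarrow> n \<ge> N \<Longrightarrow> norm (I (r m) (H k) - I (r n) (H k)) < e / 2" by auto
      have "norm (I (r m) (\<Union>i. A i) - I (r n) (\<Union>i. A i)) < e" if "m \<ge> N" "n \<ge> N" for m n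
        using N[OF that] bound[OF meas(1), of "r m" k] bound[OF meas(1), of "r n" k] k
        unfolding split real_norm_def by linarith
      then show "\<exists>N. \<forall>m\<ge>N. \<forall>n\<ge>N. norm (I (r m) (\<Union>i. A i) - I (r n) (\<Union>i. A i)) < e" by blast
    qed
  qed
  show ?thesis
  proof (rule that[OF r(1)], intro ballI allI impI)
    fix f :: "'b \<Rightarrow> real" and B assume f [measurable]: "f \<in> borel_measurable borel" and "\<forall>x. \<bar>f x\<bar> \<le> B"
    then have B: "\<bar>f x\<bar> \<le> B" for x by blast
    show "convergent (\<lambda>n. \<integral>x. f (\<phi> x) * z (r n) x \<partial>M)"
    proof (rule Cauchy_convergent, rule CauchyI)
      fix e :: real assume e: "e > 0"
      define d where "d = e / 4"
      have d: "d > 0" using e by (simp add: d_def)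
      \<comment> \<open>Rounding f down to multiples of d approximates it uniformly within d. Only
        finitely many values occur because f is bounded, so \<open>conv\<close> applies to the level
        sets.\<close>
      define s where "s x = d * of_int \<lfloor>f x / d\<rfloor>" for x
      have s: "\<bar>f x - s x\<bar> \<le> d" for x
      proof -
        have "f x - s x = d * (f x / d - of_int \<lfloor>f x / d\<rfloor>)"
          using d by (simp add: s_def right_diff_distrib)
        moreover have "0 \<le> f x / d - of_int \<lfloor>f x / d\<rfloor>" "f x / d - of_int \<lfloor>f x / d\<rfloor> \<le> 1"
          by linarith+
        ultimately show ?thesis using d by (simp add: abs_mult mult_left_le)
      qed
      define J where "J = {\<lfloor>- B / d\<rfloor>..\<lfloor>B / d\<rfloor>}"
      have J: "\<lfloor>f x / d\<rfloor> \<in> J" for x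
      proof -
        have "- B \<le> f x" "f x \<le> B" using B[of x] by linarith+
        then show ?thesis using d unfolding J_def atLeastAtMost_iff
          by (intro conjI floor_mono divide_right_mono) auto
      qed
      define L where "L j = {x. \<lfloor>f x / d\<rfloor> = j}" for j
      have L [measurable]: "L j \<in> sets borel" for j
        unfolding L_def by measurable
      have sJ: "s (\<phi> x) = (\<Sum>j\<in>J. d * of_int j * indicator (\<phi> -` L j \<inter> space M) x)" if "x \<in> space M" for x
      proof -
        have "(\<Sum>j\<in>J. d * of_int j * indicator (\<phi> -` L j \<inter> space M) x)
            = (\<Sum>j\<in>J. if j = \<lfloor>f (\<phi> x) / d\<rfloor> then d * of_int j else 0)"
          using that by (intro sum.cong) (auto simp: L_def indicator_def)
        then show ?thesis using J[of "\<phi> x"] by (simp add: s_def J_def)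
      qed
      have int_s: "(\<integral>x. s (\<phi> x) * z n x \<partial>M) = (\<Sum>j\<in>J. d * of_int j * I n (L j))" for n
      proof -
        have "(\<integral>x. s (\<phi> x) * z n x \<partial>M)
            = (\<integral>x. (\<Sum>j\<in>J. d * of_int j * (indicator (\<phi> -` L j \<inter> space M) x * z n x)) \<partial>M)"
          by (intro Bochner_Integration.integral_cong refl) (simp add: sJ sum_distrib_right mult.assoc)
        also have "\<dots> = (\<Sum>j\<in>J. (\<integral>x. d * of_int j * (indicator (\<phi> -` L j \<inter> space M) x * z n x) \<partial>M))"
          by (intro Bochner_Integration.integral_sum integrable_mult_right int L)
        finally show ?thesis by (simp add: I_def)
      qed
      have "convergent (\<lambda>n. \<integral>x. s (\<phi> x) * z (r n) x \<partial>M)"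
        unfolding int_s using conv[OF L] by (intro convergent_sum convergent_mult convergent_const)
      then have "Cauchy (\<lambda>n. \<integral>x. s (\<phi> x) * z (r n) x \<partial>M)" by (rule convergent_Cauchy)
      from CauchyD[OF this, of "e / 4"] e obtain N where
        N: "\<And>m n. m \<ge> N \<Longrightarrow> n \<ge> N \<Longrightarrow>
          norm ((\<integral>x. s (\<phi> x) * z (r m) x \<partial>M) - (\<integral>x. s (\<phi> x) * z (r n) x \<partial>M)) < e / 4" by auto
      have [measurable]: "s \<in> borel_measurable borel"
        unfolding s_def by measurable
      \<comment> \<open>The L^1 norm of \<open>z n\<close> is at most its L^2 norm, hence at most 1,
        and the error is uniform in n. Two such errors and the Cauchy gap, \<open>e / 4\<close>
        each, stay below e.\<close>
      have near: "\<bar>(\<integral>x. f (\<phi> x) * z n x \<partial>M) - (\<integral>x. s (\<phi> x) * z n x \<partial>M)\<bar> \<le> d" for n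
      proof -
        have zi: "integrable M (z n)"
          by (rule square_integrable_integrable[OF z(1)])
        have "integrable M (\<lambda>x. g (\<phi> x) * z n x)" if g: "g \<in> borel_measurable borel" "\<And>x. \<bar>g x\<bar> \<le> b"
          for g :: "'b \<Rightarrow> real" and b
        proof (rule Bochner_Integration.integrable_bound)
          show "integrable M (\<lambda>x. b * z n x)" using zi by simp
          show "AE x in M. norm (g (\<phi> x) * z n x) \<le> norm (b * z n x)"
          proof (rule AE_I2)
            fix x
            have "\<bar>g (\<phi> x)\<bar> \<le> \<bar>b\<bar>" using g(2)[of "\<phi> x"] by linarith
            then show "norm (g (\<phi> x) * z n x) \<le> norm (b * z n x)"
              by (simp add: abs_mult mult_right_mono)
          qed
          show "(\<lambda>x. g (\<phi> x) * z n x) \<in> borel_measurable M" using g(1) by measurable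
        qed
        note gi = this
        have fi: "integrable M (\<lambda>x. f (\<phi> x) * z n x)" by (rule gi[OF f B])
        have si: "integrable M (\<lambda>x. s (\<phi> x) * z n x)"
        proof (rule gi)
          fix x show "\<bar>s x\<bar> \<le> B + d" using s[of x] B[of x] by linarith
        qed measurable
        have "\<bar>(\<integral>x. f (\<phi> x) * z n x \<partial>M) - (\<integral>x. s (\<phi> x) * z n x \<partial>M)\<bar>
            = \<bar>\<integral>x. f (\<phi> x) * z n x - s (\<phi> x) * z n x \<partial>M\<bar>"
          using fi si by simp
        also have "\<dots> \<le> (\<integral>x. \<bar>f (\<phi> x) * z n x - s (\<phi> x) * z n x\<bar> \<partial>M)"
          by (rule integral_abs_bound)
        also have "\<dots> \<le> (\<integral>x. d * \<bar>z n x\<bar> \<partial>M)"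
        proof (rule integral_mono)
          fix x
          show "\<bar>f (\<phi> x) * z n x - s (\<phi> x) * z n x\<bar> \<le> d * \<bar>z n x\<bar>"
            using s[of "\<phi> x"] by (simp add: abs_mult mult_right_mono flip: left_diff_distrib)
        qed (use fi si zi in auto)
        also have "\<dots> \<le> d * 1"
        proof -
          have "(\<integral>x. \<bar>z n x\<bar> \<partial>M)\<^sup>2 \<le> 1\<^sup>2"
            using square_integral_le[OF z(1)[of n]] z(2)[of n] by simp
          then have "(\<integral>x. \<bar>z n x\<bar> \<partial>M) \<le> 1"
            by (rule power2_le_imp_le) simp
          then show ?thesis using d by simp
        qed
        finally show ?thesis by simp
      qed
      have "norm ((\<integral>x. f (\<phi> x) * z (r m) x \<partial>M) - (\<integral>x. f (\<phi> x) * z (r n) x \<partial>M)) < e"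
        if "m \<ge> N" "n \<ge> N" for m n
        using N[OF that] near[of "r m"] near[of "r n"] unfolding real_norm_def d_def by linarith
      then show "\<exists>N. \<forall>m\<ge>N. \<forall>n\<ge>N. norm ((\<integral>x. f (\<phi> x) * z (r m) x \<partial>M)
          - (\<integral>x. f (\<phi> x) * z (r n) x \<partial>M)) < e" by blast
    qed
  qed
qed

section \<open>Spectral gap of the weighted energy\<close>

text \<open>The L^2 problem on an abstract probability space, with a kernel nonnegative and bounded
  everywhere. \<open>v_adjoint_kernel\<close> states the adjoint equation in weak form.
  \<open>gain_compact\<close> says that images of sequences in the unit ball under the integral
  operator converge pointwise along a subsequence.\<close>

locale interaction_kernel = prob_space M for M :: "'a measure" +
  fixes k :: "'a \<Rightarrow> 'a \<Rightarrow> real" and C \<delta> :: real and v :: "'a \<Rightarrow> real"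
  assumes kernel_measurable [measurable]: "case_prod k \<in> borel_measurable (M \<Otimes>\<^sub>M M)"
    and kernel_nonneg: "\<And>x y. 0 \<le> k x y" and kernel_le: "\<And>x y. k x y \<le> C"
    and \<delta>_pos: "\<delta> > 0" and row_sum_ge: "AE x in M. \<delta> \<le> (\<integral>y. k x y \<partial>M)"
    and v_L2: "square_integrable M v" and v_pos: "AE x in M. v x > 0" and v_mass: "(\<integral>x. v x \<partial>M) = 1"
    and v_adjoint_kernel: "\<And>z. square_integrable M z \<Longrightarrow>
      (\<integral>x. (\<integral>y. k x y * (z y - z x) \<partial>M) * v x \<partial>M) = 0"
    and v_unique: "\<And>w. square_integrable M w \<Longrightarrow> (AE x in M. w x > 0) \<Longrightarrow> (\<integral>x. w x \<partial>M) = 1 \<Longrightarrow>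
      (\<And>z. square_integrable M z \<Longrightarrow>
        (\<integral>x. (\<integral>y. k x y * (z y - z x) \<partial>M) * w x \<partial>M) = 0) \<Longrightarrow> AE x in M. w x = v x"
    and gain_compact: "\<And>z. (\<And>n::nat. square_integrable M (z n)) \<Longrightarrow> (\<And>n. (\<integral>x. (z n x)\<^sup>2 \<partial>M) \<le> 1) \<Longrightarrow>
      \<exists>r. strict_mono r \<and> (\<forall>x\<in>space M. convergent (\<lambda>n. \<integral>y. k x y * z (r n) y \<partial>M))"
begin

sublocale P: pair_prob_space M M ..

section \<open>The operators and their bounds\<close>

text \<open>In the notation of the overview \<open>generator\<close> is A, \<open>gain\<close> is K,
  \<open>row_sum\<close> is S and \<open>dissipation\<close> is D; \<open>dual_gain\<close> is the
  transpose of K.\<close>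

definition generator :: "('a \<Rightarrow> real) \<Rightarrow> 'a \<Rightarrow> real" where
  "generator z x = (\<integral>y. k x y * (z y - z x) \<partial>M)"

definition gain :: "('a \<Rightarrow> real) \<Rightarrow> 'a \<Rightarrow> real" where
  "gain z x = (\<integral>y. k x y * z y \<partial>M)"

definition dual_gain :: "('a \<Rightarrow> real) \<Rightarrow> 'a \<Rightarrow> real" where
  "dual_gain f y = (\<integral>x. k x y * f x \<partial>M)"

definition row_sum :: "'a \<Rightarrow> real" where
  "row_sum x = (\<integral>y. k x y \<partial>M)"

definition dissipation :: "('a \<Rightarrow> real) \<Rightarrow> real" where
  "dissipation z = (\<integral>x. (\<integral>y. v x * k x y * (z y - z x)\<^sup>2 \<partial>M) \<partial>M)"

lemma C_nonneg: "0 \<le> C"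
  using kernel_nonneg[of undefined undefined] kernel_le[of undefined undefined] by linarith

lemma abs_kernel_le: "\<bar>k x y\<bar> \<le> C"
  using kernel_nonneg[of x y] kernel_le[of x y] by simp

lemma v_measurable [measurable]: "v \<in> borel_measurable M"
  using v_L2 by measurable

lemma measurable_operators [measurable]:
  assumes [measurable]: "z \<in> borel_measurable M"
  shows "gain z \<in> borel_measurable M" "dual_gain z \<in> borel_measurable M"
    "generator z \<in> borel_measurable M" "row_sum \<in> borel_measurable M"
  unfolding gain_def dual_gain_def generator_def row_sum_def by measurable

lemma integrable_kernel_mult:
  assumes z: "integrable M z"
  shows "x \<in> space M \<Longrightarrow> integrable M (\<lambda>y. k x y * z y)"
    and "y \<in> space M \<Longrightarrow> integrable M (\<lambda>x. k x y * z x)"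
proof -
  have [measurable]: "z \<in> borel_measurable M" using z by simp
  show "integrable M (\<lambda>y. k x y * z y)" if [measurable]: "x \<in> space M"
    by (rule Bochner_Integration.integrable_bound[of _ "\<lambda>y. C * z y"])
       (use z in \<open>auto simp: abs_mult C_nonneg intro!: mult_right_mono abs_kernel_le\<close>)
  show "integrable M (\<lambda>x. k x y * z x)" if [measurable]: "y \<in> space M"
    by (rule Bochner_Integration.integrable_bound[of _ "\<lambda>x. C * z x"])
       (use z in \<open>auto simp: abs_mult C_nonneg intro!: mult_right_mono abs_kernel_le\<close>)
qed

lemma row_sum_bounds:
  assumes [measurable]: "x \<in> space M"
  shows "0 \<le> row_sum x" "row_sum x \<le> C"
proof -
  show "0 \<le> row_sum x" by (simp add: row_sum_def kernel_nonneg)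
  have "integrable M (k x)" using integrable_kernel_mult(1)[of "\<lambda>_. 1" x] assms by simp
  then have "row_sum x \<le> (\<integral>y. C \<partial>M)"
    unfolding row_sum_def by (intro integral_mono) (auto intro: kernel_le)
  then show "row_sum x \<le> C" by (simp add: prob_space)
qed

lemma abs_row_sum_le: "x \<in> space M \<Longrightarrow> \<bar>row_sum x\<bar> \<le> C"
  using row_sum_bounds by simp

text \<open>A bounded kernel sends L^1 into bounded functions. This yields the bound on v and the
  dominating functions for limits of K z_n.\<close>

lemma abs_gain_le:
  assumes z: "integrable M z"
  shows "x \<in> space M \<Longrightarrow> \<bar>gain z x\<bar> \<le> C * (\<integral>y. \<bar>z y\<bar> \<partial>M)"
    and "x \<in> space M \<Longrightarrow> \<bar>dual_gain z x\<bar> \<le> C * (\<integral>y. \<bar>z y\<bar> \<partial>M)"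
proof -
  assume x: "x \<in> space M"
  have "\<bar>gain z x\<bar> \<le> (\<integral>y. \<bar>k x y * z y\<bar> \<partial>M)"
    unfolding gain_def by (rule integral_abs_bound)
  also have "\<dots> \<le> (\<integral>y. C * \<bar>z y\<bar> \<partial>M)"
    using z integrable_abs[OF integrable_kernel_mult(1)[OF z x]] abs_kernel_le
    by (intro integral_mono) (auto simp: abs_mult intro!: mult_right_mono)
  finally show "\<bar>gain z x\<bar> \<le> C * (\<integral>y. \<bar>z y\<bar> \<partial>M)" by simp
  have "\<bar>dual_gain z x\<bar> \<le> (\<integral>y. \<bar>k y x * z y\<bar> \<partial>M)"
    unfolding dual_gain_def by (rule integral_abs_bound)
  also have "\<dots> \<le> (\<integral>y. C * \<bar>z y\<bar> \<partial>M)"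
    using z integrable_abs[OF integrable_kernel_mult(2)[OF z x]] abs_kernel_le
    by (intro integral_mono) (auto simp: abs_mult intro!: mult_right_mono)
  finally show "\<bar>dual_gain z x\<bar> \<le> C * (\<integral>y. \<bar>z y\<bar> \<partial>M)" by simp
qed

lemma generator_eq:
  assumes "integrable M z" "x \<in> space M"
  shows "generator z x = gain z x - row_sum x * z x"
proof -
  have "integrable M (k x)" using integrable_kernel_mult(1)[of "\<lambda>_. 1" x] assms(2) by simp
  then show ?thesis
    using integrable_kernel_mult(1)[OF assms]
    by (simp add: generator_def gain_def row_sum_def right_diff_distrib)
qed

lemma square_integrable_operators:
  assumes z: "square_integrable M z"
  shows "square_integrable M (gain z)" "square_integrable M (dual_gain z)"
    "square_integrable M (\<lambda>x. row_sum x * z x)" "square_integrable M (generator z)"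
proof -
  note [measurable] = z
  have zi: "integrable M z" using z by (rule square_integrable_integrable)
  show 1: "square_integrable M (gain z)" "square_integrable M (dual_gain z)"
    using abs_gain_le[OF zi] by (auto intro!: square_integrable_bounded AE_I2)
  show 2: "square_integrable M (\<lambda>x. row_sum x * z x)"
    by (rule square_integrable_bounded_mult[OF z _ AE_I2[OF abs_row_sum_le]]) (use z in measurable)
  have "square_integrable M (\<lambda>x. gain z x - row_sum x * z x)"
    by (rule square_integrable_diff[OF 1(1) 2])
  then show "square_integrable M (generator z)"
    by (rule square_integrable_cong_AE) (auto simp: generator_eq[OF zi])
qed

lemma integrable_pair:
  assumes f: "integrable M f" and g: "integrable M g"
  shows "integrable (M \<Otimes>\<^sub>M M) (\<lambda>(x, y). f x * (k x y * g y))"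
proof -
  note [measurable] = borel_measurable_integrable[OF f] borel_measurable_integrable[OF g]
  have fg: "integrable (M \<Otimes>\<^sub>M M) (\<lambda>(x, y). f x * g y)"
    using f g by (intro P.Fubini_integrable) (auto simp: abs_mult)
  show ?thesis
  proof (rule Bochner_Integration.integrable_bound)
    show "integrable (M \<Otimes>\<^sub>M M) (\<lambda>p. C * (case p of (x, y) \<Rightarrow> f x * g y))"
      using fg by simp
    show "AE p in M \<Otimes>\<^sub>M M. norm (case p of (x, y) \<Rightarrow> f x * (k x y * g y))
        \<le> norm (C * (case p of (x, y) \<Rightarrow> f x * g y))"
    proof (rule AE_I2, clarify)
      fix x y
      have "\<bar>k x y\<bar> * \<bar>f x * g y\<bar> \<le> C * \<bar>f x * g y\<bar>"
        by (intro mult_right_mono abs_kernel_le) simp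
      then show "norm (f x * (k x y * g y)) \<le> norm (C * (f x * g y))"
        by (simp add: abs_mult C_nonneg mult_ac)
    qed
  qed measurable
qed

text \<open>The two orders of integration of one double integral; together they express the duality
  of \<open>gain\<close> and \<open>dual_gain\<close>.\<close>

lemma integral_pair:
  assumes f: "integrable M f" and g: "integrable M g"
  shows "(\<integral>p. (case p of (x, y) \<Rightarrow> f x * (k x y * g y)) \<partial>(M \<Otimes>\<^sub>M M)) = (\<integral>x. f x * gain g x \<partial>M)"
    and "(\<integral>p. (case p of (x, y) \<Rightarrow> f x * (k x y * g y)) \<partial>(M \<Otimes>\<^sub>M M)) = (\<integral>y. dual_gain f y * g y \<partial>M)"
proof -
  show "(\<integral>p. (case p of (x, y) \<Rightarrow> f x * (k x y * g y)) \<partial>(M \<Otimes>\<^sub>M M)) = (\<integral>x. f x * gain g x \<partial>M)"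
    unfolding P.integral_fst[OF integrable_pair[OF f g], symmetric] gain_def by simp
  have "(\<integral>x. f x * (k x y * g y) \<partial>M) = dual_gain f y * g y" for y
  proof -
    have "(\<integral>x. f x * (k x y * g y) \<partial>M) = (\<integral>x. k x y * f x * g y \<partial>M)"
      by (simp add: mult_ac)
    then show ?thesis by (simp add: dual_gain_def)
  qed
  then show "(\<integral>p. (case p of (x, y) \<Rightarrow> f x * (k x y * g y)) \<partial>(M \<Otimes>\<^sub>M M)) = (\<integral>y. dual_gain f y * g y \<partial>M)"
    unfolding P.integral_snd[OF integrable_pair[OF f g], symmetric] by simp
qed

text \<open>Test \<open>A\<^sup>* v = 0\<close> with the difference of the two sides.\<close>

lemma dual_gain_weight: "AE y in M. dual_gain v y = row_sum y * v y"
proof -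
  define h where "h y = dual_gain v y - row_sum y * v y" for y
  have h: "square_integrable M h"
    unfolding h_def by (intro square_integrable_diff square_integrable_operators v_L2)
  note [measurable] = h
  have hi: "integrable M h" and vi: "integrable M v"
    using h v_L2 by (simp_all add: square_integrable_integrable)
  have "0 = (\<integral>x. generator h x * v x \<partial>M)"
    using v_adjoint_kernel[OF h] by (simp add: generator_def)
  also have "\<dots> = (\<integral>x. v x * gain h x - (row_sum x * v x) * h x \<partial>M)"
    by (intro Bochner_Integration.integral_cong refl) (simp add: generator_eq[OF hi] algebra_simps)
  also have "\<dots> = (\<integral>x. v x * gain h x \<partial>M) - (\<integral>x. (row_sum x * v x) * h x \<partial>M)"
    by (intro Bochner_Integration.integral_diff square_integrable_mult square_integrable_operators h v_L2)
  also have "(\<integral>x. v x * gain h x \<partial>M) = (\<integral>x. dual_gain v x * h x \<partial>M)"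
    using integral_pair[OF vi hi] by simp
  also have "(\<integral>x. dual_gain v x * h x \<partial>M) - (\<integral>x. (row_sum x * v x) * h x \<partial>M)
      = (\<integral>x. dual_gain v x * h x - (row_sum x * v x) * h x \<partial>M)"
    by (intro Bochner_Integration.integral_diff[symmetric] square_integrable_mult square_integrable_operators h v_L2)
  also have "\<dots> = (\<integral>x. (h x)\<^sup>2 \<partial>M)"
    by (intro Bochner_Integration.integral_cong refl) (simp add: h_def power2_eq_square algebra_simps)
  finally have "AE x in M. (h x)\<^sup>2 = 0"
    using integral_nonneg_eq_0_iff_AE[OF square_integrable_power2[OF h]] by simp
  then show ?thesis by (auto simp: h_def)
qed

lemma row_sum_ge': "AE x in M. \<delta> \<le> row_sum x"
  using row_sum_ge by (simp add: row_sum_def)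

text \<open>By the adjoint equation S v is the transpose of K applied to v, which is at most C times
  the mass 1 of v; divide by the lower bound \<delta> of S.\<close>

lemma v_bounded: "AE x in M. v x \<le> C / \<delta>"
proof -
  have vi: "integrable M v" using v_L2 by (rule square_integrable_integrable)
  have "(\<integral>x. \<bar>v x\<bar> \<partial>M) = (\<integral>x. v x \<partial>M)"
    using v_pos by (intro integral_cong_AE) auto
  then have bound: "x \<in> space M \<Longrightarrow> \<bar>dual_gain v x\<bar> \<le> C" for x
    using abs_gain_le(2)[OF vi, of x] v_mass by simp
  show ?thesis
    using dual_gain_weight row_sum_ge' v_pos AE_space
  proof eventually_elim
    case (elim x)
    have "\<delta> * v x \<le> row_sum x * v x" using elim by (intro mult_right_mono) auto
    also have "\<dots> \<le> C" using elim bound[of x] by simp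
    finally show ?case using \<delta>_pos by (simp add: field_simps)
  qed
qed

lemma abs_v_le: "AE x in M. \<bar>v x\<bar> \<le> C / \<delta>"
  using v_bounded v_pos by eventually_elim simp

lemma square_integrable_v_mult: "square_integrable M z \<Longrightarrow> square_integrable M (\<lambda>x. v x * z x)"
  by (rule square_integrable_bounded_mult[OF _ v_measurable abs_v_le])

lemma integrable_v_power2:
  "square_integrable M z \<Longrightarrow> integrable M (\<lambda>x. v x * (z x)\<^sup>2)"
  using square_integrable_mult[OF square_integrable_v_mult, of z z] by (simp add: power2_eq_square mult.assoc)

lemma integral_v_power2_nonneg: "0 \<le> (\<integral>x. v x * (z x)\<^sup>2 \<partial>M)"
  using v_pos by (intro integral_nonneg_AE) (auto elim!: eventually_mono)

section \<open>Dissipation: identities and bounds\<close>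

text \<open>The density v(x) k(x, y) has the marginal S v in both variables: in x by definition, in
  y by \<open>dual_gain_weight\<close>. The factor \<open>1\<close> fits the integrand to
  \<open>integrable_pair\<close>.\<close>

lemma pair_square_integrals:
  assumes z: "square_integrable M z"
  shows "integrable (M \<Otimes>\<^sub>M M) (\<lambda>(x, y). v x * (k x y * (z y)\<^sup>2))"
    and "(\<integral>p. (case p of (x, y) \<Rightarrow> v x * (k x y * (z y)\<^sup>2)) \<partial>(M \<Otimes>\<^sub>M M))
      = (\<integral>x. row_sum x * v x * (z x)\<^sup>2 \<partial>M)"
    and "integrable (M \<Otimes>\<^sub>M M) (\<lambda>(x, y). (v x * (z x)\<^sup>2) * (k x y * 1))"
    and "(\<integral>p. (case p of (x, y) \<Rightarrow> (v x * (z x)\<^sup>2) * (k x y * 1)) \<partial>(M \<Otimes>\<^sub>M M))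
      = (\<integral>x. row_sum x * v x * (z x)\<^sup>2 \<partial>M)"
proof -
  have vi: "integrable M v" and z2: "integrable M (\<lambda>x. (z x)\<^sup>2)"
    and vz2: "integrable M (\<lambda>x. v x * (z x)\<^sup>2)" and one: "integrable M (\<lambda>x. 1::real)"
    using z v_L2 square_integrable_integrable by (auto simp: square_integrable_power2 integrable_v_power2)
  note [measurable] = z
  show "integrable (M \<Otimes>\<^sub>M M) (\<lambda>(x, y). v x * (k x y * (z y)\<^sup>2))"
    "integrable (M \<Otimes>\<^sub>M M) (\<lambda>(x, y). (v x * (z x)\<^sup>2) * (k x y * 1))"
    by (rule integrable_pair[OF vi z2] integrable_pair[OF vz2 one])+
  have "(\<integral>y. dual_gain v y * (z y)\<^sup>2 \<partial>M) = (\<integral>x. row_sum x * v x * (z x)\<^sup>2 \<partial>M)"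
    using dual_gain_weight by (intro integral_cong_AE) (auto elim!: eventually_mono)
  then show "(\<integral>p. (case p of (x, y) \<Rightarrow> v x * (k x y * (z y)\<^sup>2)) \<partial>(M \<Otimes>\<^sub>M M))
      = (\<integral>x. row_sum x * v x * (z x)\<^sup>2 \<partial>M)"
    using integral_pair(2)[OF vi z2] by simp
  have "(\<integral>x. v x * (z x)\<^sup>2 * gain (\<lambda>_. 1) x \<partial>M) = (\<integral>x. row_sum x * v x * (z x)\<^sup>2 \<partial>M)"
    by (simp add: gain_def row_sum_def mult_ac)
  then show "(\<integral>p. (case p of (x, y) \<Rightarrow> (v x * (z x)\<^sup>2) * (k x y * 1)) \<partial>(M \<Otimes>\<^sub>M M))
      = (\<integral>x. row_sum x * v x * (z x)\<^sup>2 \<partial>M)"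
    using integral_pair(1)[OF vz2 one] by simp
qed

text \<open>Expanding the square leaves a mixed term and two squares, whose integrals agree by
  \<open>pair_square_integrals\<close>.\<close>

lemma dissipation_integrable:
  assumes z: "square_integrable M z"
  shows "integrable (M \<Otimes>\<^sub>M M) (\<lambda>(x, y). v x * k x y * (z y - z x)\<^sup>2)"
    and "dissipation z = (\<integral>p. (case p of (x, y) \<Rightarrow> v x * k x y * (z y - z x)\<^sup>2) \<partial>(M \<Otimes>\<^sub>M M))"
    and "dissipation z = 2 * (\<integral>x. row_sum x * v x * (z x)\<^sup>2 \<partial>M) - 2 * (\<integral>x. v x * z x * gain z x \<partial>M)"
proof -
  have zi: "integrable M z" and vz: "integrable M (\<lambda>x. v x * z x)"
    using z square_integrable_v_mult[OF z] square_integrable_integrable by auto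
  let ?a = "\<lambda>(x, y). v x * (k x y * (z y)\<^sup>2)"
    and ?b = "\<lambda>(x, y). (v x * (z x)\<^sup>2) * (k x y * 1)"
    and ?c = "\<lambda>(x, y). (v x * z x) * (k x y * z y)"
  note pair = pair_square_integrals[OF z] integrable_pair[OF vz zi] integral_pair(1)[OF vz zi]
  have eq: "(\<lambda>(x, y). v x * k x y * (z y - z x)\<^sup>2) = (\<lambda>p. ?a p + ?b p - 2 * ?c p)"
    by (auto simp: fun_eq_iff power2_eq_square algebra_simps)
  show I: "integrable (M \<Otimes>\<^sub>M M) (\<lambda>(x, y). v x * k x y * (z y - z x)\<^sup>2)"
    unfolding eq using pair by simp
  show D: "dissipation z = (\<integral>p. (case p of (x, y) \<Rightarrow> v x * k x y * (z y - z x)\<^sup>2) \<partial>(M \<Otimes>\<^sub>M M))"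
    unfolding dissipation_def by (rule P.integral_fst[OF I])
  show "dissipation z = 2 * (\<integral>x. row_sum x * v x * (z x)\<^sup>2 \<partial>M) - 2 * (\<integral>x. v x * z x * gain z x \<partial>M)"
    unfolding D eq using pair by simp
qed

lemma dissipation_nonneg: "0 \<le> dissipation z"
  unfolding dissipation_def
  using v_pos kernel_nonneg
  by (intro integral_nonneg_AE) (auto elim!: eventually_mono intro!: integral_nonneg_AE)

lemma weighted_energy_identity:
  assumes z: "square_integrable M z"
  shows "2 * (\<integral>x. v x * z x * generator z x \<partial>M) = - dissipation z"
proof -
  have zi: "integrable M z" using z by (rule square_integrable_integrable)
  have "(\<integral>x. v x * z x * generator z x \<partial>M)
      = (\<integral>x. v x * z x * gain z x - (v x * z x) * (row_sum x * z x) \<partial>M)"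
    by (intro Bochner_Integration.integral_cong refl) (simp add: generator_eq[OF zi] algebra_simps)
  also have "\<dots> = (\<integral>x. v x * z x * gain z x \<partial>M) - (\<integral>x. (v x * z x) * (row_sum x * z x) \<partial>M)"
    by (intro Bochner_Integration.integral_diff square_integrable_mult square_integrable_operators
        square_integrable_v_mult z)
  finally show ?thesis
    unfolding dissipation_integrable(3)[OF z] by (simp add: power2_eq_square mult_ac)
qed

lemma AE_pair_v_pos: "AE p in M \<Otimes>\<^sub>M M. v (fst p) > 0"
  using v_pos by (intro P.AE_pair_measure) (auto elim!: eventually_mono)

text \<open>The square of a difference is at most twice the sum of the squares, the two squares have
  equal integrals, and S is at most C; hence the factor 4 C.\<close>

lemma dissipation_le:
  assumes z: "square_integrable M z"
  shows "dissipation z \<le> 4 * C * (\<integral>x. v x * (z x)\<^sup>2 \<partial>M)"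
proof -
  note [measurable] = z
  note pair = pair_square_integrals[OF z]
  have "dissipation z \<le> (\<integral>p. 2 * (case p of (x, y) \<Rightarrow> v x * (k x y * (z y)\<^sup>2))
      + 2 * (case p of (x, y) \<Rightarrow> (v x * (z x)\<^sup>2) * (k x y * 1)) \<partial>(M \<Otimes>\<^sub>M M))"
    unfolding dissipation_integrable(2)[OF z]
  proof (rule integral_mono_AE)
    show "AE p in M \<Otimes>\<^sub>M M. (case p of (x, y) \<Rightarrow> v x * k x y * (z y - z x)\<^sup>2)
        \<le> 2 * (case p of (x, y) \<Rightarrow> v x * (k x y * (z y)\<^sup>2))
          + 2 * (case p of (x, y) \<Rightarrow> (v x * (z x)\<^sup>2) * (k x y * 1))"
      using AE_pair_v_pos
    proof (rule eventually_mono, clarsimp)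
      fix x y assume "0 < v x"
      have "(z y - z x)\<^sup>2 \<le> 2 * (z y)\<^sup>2 + 2 * (z x)\<^sup>2"
        using zero_le_power2[of "z y + z x"] by (simp add: power2_eq_square algebra_simps)
      then have "v x * k x y * (z y - z x)\<^sup>2 \<le> v x * k x y * (2 * (z y)\<^sup>2 + 2 * (z x)\<^sup>2)"
        using \<open>0 < v x\<close> kernel_nonneg by (intro mult_left_mono) auto
      then show "v x * k x y * (z y - z x)\<^sup>2 \<le> 2 * (v x * (k x y * (z y)\<^sup>2)) + 2 * (v x * (z x)\<^sup>2 * k x y)"
        by (simp add: algebra_simps)
    qed
  qed (use dissipation_integrable(1)[OF z] pair in auto)
  also have "\<dots> = 4 * (\<integral>x. row_sum x * v x * (z x)\<^sup>2 \<partial>M)"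
    using pair by simp
  also have "(\<integral>x. row_sum x * v x * (z x)\<^sup>2 \<partial>M) \<le> (\<integral>x. C * (v x * (z x)\<^sup>2) \<partial>M)"
  proof (rule integral_mono_AE)
    show "integrable M (\<lambda>x. row_sum x * v x * (z x)\<^sup>2)"
      using square_integrable_mult[OF square_integrable_v_mult[OF z] square_integrable_operators(3)[OF z]]
      by (simp add: power2_eq_square mult_ac)
    show "AE x in M. row_sum x * v x * (z x)\<^sup>2 \<le> C * (v x * (z x)\<^sup>2)"
      using v_pos AE_space
    proof eventually_elim
      case (elim x)
      then show ?case
        using mult_right_mono[OF row_sum_bounds(2), of x "v x * (z x)\<^sup>2"] by (simp add: mult.assoc)
    qed
  qed (simp add: integrable_v_power2[OF z])
  finally show ?thesis by simp
qed

text \<open>D is the square of a seminorm. Together with \<open>dissipation_le\<close>, this lets a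
  vanishing D pass to limits in the weighted norm.\<close>

lemma dissipation_add_le:
  assumes f: "square_integrable M f" and g: "square_integrable M g"
  shows "dissipation (\<lambda>x. f x + g x) \<le> 2 * dissipation f + 2 * dissipation g"
proof -
  note fg = square_integrable_add[OF f g]
  have "dissipation (\<lambda>x. f x + g x) \<le> (\<integral>p. 2 * (case p of (x, y) \<Rightarrow> v x * k x y * (f y - f x)\<^sup>2)
      + 2 * (case p of (x, y) \<Rightarrow> v x * k x y * (g y - g x)\<^sup>2) \<partial>(M \<Otimes>\<^sub>M M))"
    unfolding dissipation_integrable(2)[OF fg]
  proof (rule integral_mono_AE)
    show "AE p in M \<Otimes>\<^sub>M M. (case p of (x, y) \<Rightarrow> v x * k x y * (f y + g y - (f x + g x))\<^sup>2)
        \<le> 2 * (case p of (x, y) \<Rightarrow> v x * k x y * (f y - f x)\<^sup>2)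
          + 2 * (case p of (x, y) \<Rightarrow> v x * k x y * (g y - g x)\<^sup>2)"
      using AE_pair_v_pos
    proof (rule eventually_mono, clarsimp)
      fix x y assume "0 < v x"
      have "(f y + g y - (f x + g x))\<^sup>2 \<le> 2 * (f y - f x)\<^sup>2 + 2 * (g y - g x)\<^sup>2"
        using zero_le_power2[of "f y - f x - (g y - g x)"] by (simp add: power2_eq_square algebra_simps)
      then have "v x * k x y * (f y + g y - (f x + g x))\<^sup>2
          \<le> v x * k x y * (2 * (f y - f x)\<^sup>2 + 2 * (g y - g x)\<^sup>2)"
        using \<open>0 < v x\<close> kernel_nonneg by (intro mult_left_mono) auto
      then show "v x * k x y * (f y + g y - (f x + g x))\<^sup>2
          \<le> 2 * (v x * k x y * (f y - f x)\<^sup>2) + 2 * (v x * k x y * (g y - g x)\<^sup>2)"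
        by (simp add: algebra_simps)
    qed
  qed (use dissipation_integrable(1)[OF fg] dissipation_integrable(1)[OF f] dissipation_integrable(1)[OF g] in auto)
  then show ?thesis
    using dissipation_integrable[OF f] dissipation_integrable[OF g] by simp
qed

text \<open>For fixed x, \<open>square_integral_le\<close> bounds (A z)(x)^2 by the integral of k^2
  (z(y) - z(x))^2; one of the two factors k is then replaced by C.\<close>

lemma weighted_generator_le:
  assumes z: "square_integrable M z"
  shows "(\<integral>x. v x * (generator z x)\<^sup>2 \<partial>M) \<le> C * dissipation z"
proof -
  note [measurable] = z
  have "(\<integral>x. v x * (generator z x)\<^sup>2 \<partial>M) \<le> (\<integral>x. C * (\<integral>y. v x * k x y * (z y - z x)\<^sup>2 \<partial>M) \<partial>M)"
  proof (rule integral_mono_AE)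
    show "integrable M (\<lambda>x. v x * (generator z x)\<^sup>2)"
      by (intro integrable_v_power2 square_integrable_operators z)
    show "integrable M (\<lambda>x. C * (\<integral>y. v x * k x y * (z y - z x)\<^sup>2 \<partial>M))"
      using P.integrable_fst[OF dissipation_integrable(1)[OF z]] by simp
    show "AE x in M. v x * (generator z x)\<^sup>2 \<le> C * (\<integral>y. v x * k x y * (z y - z x)\<^sup>2 \<partial>M)"
      using v_pos AE_space
    proof eventually_elim
      case (elim x)
      then have [measurable]: "x \<in> space M" by simp
      have d: "square_integrable M (\<lambda>y. z y - z x)"
        by (intro square_integrable_diff z square_integrable_bounded[of _ "\<bar>z x\<bar>"]) auto
      have kd: "square_integrable M (\<lambda>y. k x y * (z y - z x))"
        by (rule square_integrable_bounded_mult[OF d _ AE_I2[OF abs_kernel_le]]) measurable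
      have "(generator z x)\<^sup>2 \<le> (\<integral>y. \<bar>k x y * (z y - z x)\<bar> \<partial>M)\<^sup>2"
        unfolding generator_def
        by (rule abs_le_square_iff[THEN iffD1]) (use integral_abs_bound in \<open>auto intro: order_trans\<close>)
      also have "\<dots> \<le> (\<integral>y. (k x y * (z y - z x))\<^sup>2 \<partial>M)"
        by (rule square_integral_le[OF kd])
      also have "\<dots> \<le> (\<integral>y. C * (k x y * (z y - z x)\<^sup>2) \<partial>M)"
      proof (rule integral_mono)
        show "integrable M (\<lambda>y. (k x y * (z y - z x))\<^sup>2)"
          by (rule square_integrable_power2[OF kd])
        show "integrable M (\<lambda>y. C * (k x y * (z y - z x)\<^sup>2))"
          using integrable_kernel_mult(1)[OF square_integrable_power2[OF d] \<open>x \<in> space M\<close>] by simp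
        fix y
        have "k x y * (k x y * (z y - z x)\<^sup>2) \<le> C * (k x y * (z y - z x)\<^sup>2)"
          by (intro mult_right_mono kernel_le) (simp add: kernel_nonneg)
        then show "(k x y * (z y - z x))\<^sup>2 \<le> C * (k x y * (z y - z x)\<^sup>2)"
          by (simp add: power2_eq_square mult_ac)
      qed
      finally have "v x * (generator z x)\<^sup>2 \<le> v x * (C * (\<integral>y. k x y * (z y - z x)\<^sup>2 \<partial>M))"
        using elim by (intro mult_left_mono) auto
      then show ?case by (simp add: mult_ac)
    qed
  qed
  then show ?thesis by (simp add: dissipation_def)
qed

text \<open>
  If \<open>D(z) = 0\<close>, then \<open>A\<close> commutes with multiplication by every bounded function of \<open>z\<close>.  Hence
  \<open>(2 + arctan z) v\<close> is again in the kernel of \<open>A\<^sup>*\<close>, and it is positive.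
\<close>

lemma dissipation_eq_0D:
  assumes z: "square_integrable M z" and D: "dissipation z = 0"
  shows "AE x in M. z x = (\<integral>x. z x * v x \<partial>M)"
proof -
  note [measurable] = z
  from AE_pair_v_pos have "AE p in M \<Otimes>\<^sub>M M. 0 \<le> (case p of (x, y) \<Rightarrow> v x * k x y * (z y - z x)\<^sup>2)"
    by (rule eventually_mono) (auto simp: kernel_nonneg)
  then have "AE p in M \<Otimes>\<^sub>M M. (case p of (x, y) \<Rightarrow> v x * k x y * (z y - z x)\<^sup>2) = 0"
    using integral_nonneg_eq_0_iff_AE[OF dissipation_integrable(1)[OF z]] D dissipation_integrable(2)[OF z]
    by simp
  from P.AE_pair[OF this] have ae: "AE x in M. AE y in M. v x * k x y * (z y - z x)\<^sup>2 = 0"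
    by simp
  \<comment> \<open>Since arctan lies in (-2, 2), \<phi> is bounded, which keeps products in L^2,
    and positive, which makes \<phi> v admissible for uniqueness; injectivity of arctan recovers
    z.\<close>
  define \<phi> where "\<phi> x = 2 + arctan (z x)" for x
  have \<phi>_bounds: "0 < \<phi> x" "\<phi> x < 4" for x
    using arctan_bounded[of "z x"] pi_less_4 by (auto simp: \<phi>_def)
  have [measurable]: "\<phi> \<in> borel_measurable M"
    unfolding \<phi>_def by measurable
  have \<phi>_mult: "square_integrable M (\<lambda>x. \<phi> x * u x)" if "square_integrable M u" for u
    by (rule square_integrable_bounded_mult[OF that, of _ 4]) (use \<phi>_bounds in \<open>auto simp: abs_of_pos intro!: AE_I2 less_imp_le\<close>)
  \<comment> \<open>For almost all x and y either \<open>k x y = 0\<close> or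
    \<open>z y = z x\<close>, so \<open>\<phi> x\<close> can be pulled out of the integral.\<close>
  have comm: "AE x in M. generator (\<lambda>x. \<phi> x * u x) x = \<phi> x * generator u x" if u: "square_integrable M u" for u
    using ae v_pos AE_space
  proof eventually_elim
    case (elim x)
    note [measurable] = u \<open>x \<in> space M\<close>
    have "generator (\<lambda>x. \<phi> x * u x) x = (\<integral>y. \<phi> x * (k x y * (u y - u x)) \<partial>M)"
      unfolding generator_def
    proof (rule integral_cong_AE)
      show "AE y in M. k x y * (\<phi> y * u y - \<phi> x * u x) = \<phi> x * (k x y * (u y - u x))"
        using elim(1)
      proof eventually_elim
        case (elim y)
        with \<open>0 < v x\<close> have "k x y = 0 \<or> \<phi> y = \<phi> x" by (auto simp: \<phi>_def)
        then show ?case by (auto simp: algebra_simps)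
      qed
    qed measurable
    then show ?case by (simp add: generator_def)
  qed
  define c where "c = (\<integral>x. \<phi> x * v x \<partial>M)"
  have \<phi>v: "integrable M (\<lambda>x. \<phi> x * v x)"
    by (rule square_integrable_integrable[OF \<phi>_mult[OF v_L2]])
  have \<phi>v_pos: "AE x in M. 0 < \<phi> x * v x"
    using v_pos by eventually_elim (use \<phi>_bounds in simp)
  then have \<phi>v_nonneg: "AE x in M. 0 \<le> \<phi> x * v x"
    by (rule eventually_mono) simp
  have "c \<noteq> 0"
  proof
    assume "c = 0"
    then have "AE x in M. \<phi> x * v x = 0"
      using integral_nonneg_eq_0_iff_AE[OF \<phi>v \<phi>v_nonneg] by (simp only: c_def)
    then have "AE x in M. False"
      using \<phi>v_pos by eventually_elim auto
    then show False by simp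
  qed
  moreover have "c \<ge> 0"
    unfolding c_def by (rule integral_nonneg_AE[OF \<phi>v_nonneg])
  ultimately have c: "c > 0" by simp
  have "AE x in M. (1 / c) * (\<phi> x * v x) = v x"
  proof (rule v_unique)
    show "square_integrable M (\<lambda>x. (1 / c) * (\<phi> x * v x))"
      by (intro square_integrable_cmult \<phi>_mult v_L2)
    show "AE x in M. 0 < (1 / c) * (\<phi> x * v x)"
      using \<phi>v_pos by eventually_elim (use c in simp)
    show "(\<integral>x. (1 / c) * (\<phi> x * v x) \<partial>M) = 1"
      using c by (simp add: c_def)
    fix u assume u: "square_integrable M u"
    note [measurable] = u
    have "(\<integral>x. generator u x * ((1 / c) * (\<phi> x * v x)) \<partial>M)
        = (\<integral>x. (1 / c) * (generator (\<lambda>x. \<phi> x * u x) x * v x) \<partial>M)"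
    proof (rule integral_cong_AE)
      show "AE x in M. generator u x * ((1 / c) * (\<phi> x * v x))
          = (1 / c) * (generator (\<lambda>x. \<phi> x * u x) x * v x)"
        using comm[OF u] by eventually_elim simp
    qed measurable
    also have "\<dots> = 0"
      using v_adjoint_kernel[OF \<phi>_mult[OF u]] by (simp add: generator_def)
    finally show "(\<integral>x. (\<integral>y. k x y * (u y - u x) \<partial>M) * ((1 / c) * (\<phi> x * v x)) \<partial>M) = 0"
      by (simp add: generator_def)
  qed
  \<comment> \<open>Uniqueness of v makes \<phi> equal to c almost everywhere. Integrating against
    v, of mass 1, then identifies the constant value of z.\<close>
  then have const: "AE x in M. z x = tan (c - 2)"
    using v_pos
  proof eventually_elim
    case (elim x)
    then have "\<phi> x = c" using c by (simp add: field_simps)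
    then have "arctan (z x) = c - 2" by (simp add: \<phi>_def)
    then show ?case by (metis tan_arctan)
  qed
  then have "(\<integral>x. z x * v x \<partial>M) = (\<integral>x. tan (c - 2) * v x \<partial>M)"
    by (intro integral_cong_AE) (auto elim!: eventually_mono)
  with const show ?thesis by (simp add: v_mass)
qed

section \<open>Compactness argument for the spectral gap\<close>

lemma generator_cmult: "generator (\<lambda>x. a * z x) x = a * generator z x"
proof -
  have "(\<lambda>y. k x y * (a * z y - a * z x)) = (\<lambda>y. a * (k x y * (z y - z x)))"
    by (simp add: fun_eq_iff algebra_simps)
  then show ?thesis by (simp add: generator_def)
qed

lemma dissipation_cmult: "dissipation (\<lambda>x. a * z x) = a\<^sup>2 * dissipation z"
proof -
  have "v x * k x y * (a * z y - a * z x)\<^sup>2 = a\<^sup>2 * (v x * k x y * (z y - z x)\<^sup>2)" for x y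
    by (simp add: power2_eq_square algebra_simps)
  then show ?thesis by (simp only: dissipation_def integral_mult_right_zero)
qed

lemma abs_gain_le_unit:
  assumes z: "square_integrable M z" "(\<integral>x. (z x)\<^sup>2 \<partial>M) \<le> 1" and x: "x \<in> space M"
  shows "\<bar>gain z x\<bar> \<le> C"
proof -
  have "(\<integral>x. \<bar>z x\<bar> \<partial>M)\<^sup>2 \<le> 1\<^sup>2"
    using square_integral_le[OF z(1)] z(2) by simp
  then have "(\<integral>x. \<bar>z x\<bar> \<partial>M) \<le> 1"
    by (rule power2_le_imp_le) simp
  then have "C * (\<integral>x. \<bar>z x\<bar> \<partial>M) \<le> C * 1"
    by (intro mult_left_mono C_nonneg)
  then show ?thesis
    using abs_gain_le(1)[OF square_integrable_integrable[OF z(1)] x] by simp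
qed

lemma energy_eq:
  assumes z: "square_integrable M z"
  shows "(\<integral>x. z x * generator z x \<partial>M) = (\<integral>x. z x * gain z x \<partial>M) - (\<integral>x. row_sum x * (z x)\<^sup>2 \<partial>M)"
proof -
  have zi: "integrable M z" using z by (rule square_integrable_integrable)
  have "(\<integral>x. z x * generator z x \<partial>M) = (\<integral>x. z x * gain z x - z x * (row_sum x * z x) \<partial>M)"
    by (intro Bochner_Integration.integral_cong refl) (simp add: generator_eq[OF zi] algebra_simps)
  also have "\<dots> = (\<integral>x. z x * gain z x \<partial>M) - (\<integral>x. z x * (row_sum x * z x) \<partial>M)"
    by (intro Bochner_Integration.integral_diff square_integrable_mult square_integrable_operators z)
  finally show ?thesis by (simp add: power2_eq_square mult_ac)
qed

lemma row_sum_energy_ge: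
  assumes z: "square_integrable M z"
  shows "\<delta> * (\<integral>x. (z x)\<^sup>2 \<partial>M) \<le> (\<integral>x. row_sum x * (z x)\<^sup>2 \<partial>M)"
proof -
  have "(\<integral>x. \<delta> * (z x)\<^sup>2 \<partial>M) \<le> (\<integral>x. row_sum x * (z x)\<^sup>2 \<partial>M)"
  proof (rule integral_mono_AE)
    show "integrable M (\<lambda>x. row_sum x * (z x)\<^sup>2)"
      using square_integrable_mult[OF z square_integrable_operators(3)[OF z]]
      by (simp add: power2_eq_square mult_ac)
    show "AE x in M. \<delta> * (z x)\<^sup>2 \<le> row_sum x * (z x)\<^sup>2"
      using row_sum_ge' by eventually_elim (simp add: mult_right_mono)
  qed (simp add: square_integrable_power2[OF z])
  then show ?thesis by simp
qed

lemma gain_energy_le: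
  assumes z: "square_integrable M z" "(\<integral>x. (z x)\<^sup>2 \<partial>M) \<le> 1"
  shows "(\<integral>x. z x * gain z x \<partial>M) \<le> sqrt (\<integral>x. (gain z x)\<^sup>2 \<partial>M)"
proof (rule real_le_rsqrt)
  have "(\<integral>x. z x * gain z x \<partial>M)\<^sup>2 \<le> (\<integral>x. (z x)\<^sup>2 \<partial>M) * (\<integral>x. (gain z x)\<^sup>2 \<partial>M)"
    by (intro Cauchy_Schwarz_integral z square_integrable_operators)
  also have "\<dots> \<le> 1 * (\<integral>x. (gain z x)\<^sup>2 \<partial>M)"
    by (intro mult_right_mono z) simp
  finally show "(\<integral>x. z x * gain z x \<partial>M)\<^sup>2 \<le> (\<integral>x. (gain z x)\<^sup>2 \<partial>M)" by simp
qed

lemma gain_power2_integral_le: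
  assumes z: "square_integrable M z" "(\<integral>x. (z x)\<^sup>2 \<partial>M) \<le> 1"
  shows "(\<integral>x. (gain z x)\<^sup>2 \<partial>M) \<le> C\<^sup>2"
proof -
  have "(\<integral>x. (gain z x)\<^sup>2 \<partial>M) \<le> (\<integral>x. C\<^sup>2 \<partial>M)"
  proof (rule integral_mono)
    show "integrable M (\<lambda>x. (gain z x)\<^sup>2)"
      by (intro square_integrable_power2 square_integrable_operators z)
    show "(gain z x)\<^sup>2 \<le> C\<^sup>2" if "x \<in> space M" for x
      using abs_gain_le_unit[OF z that] C_nonneg by (simp add: abs_le_square_iff[symmetric])
  qed simp
  then show ?thesis by (simp add: prob_space)
qed

lemma vanishing_dissipation_imp_vanishing_gain:
  assumes y: "\<And>n::nat. square_integrable M (y n)" "\<And>n. (\<integral>x. (y n x)\<^sup>2 \<partial>M) \<le> 1"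
    and mean: "\<And>n. (\<integral>x. y n x * v x \<partial>M) = 0"
    and D: "(\<lambda>n. dissipation (y n)) \<longlonglongrightarrow> 0"
    and conv: "\<And>x. x \<in> space M \<Longrightarrow> convergent (\<lambda>n. gain (y n) x)"
  shows "(\<lambda>n. \<integral>x. (gain (y n) x)\<^sup>2 \<partial>M) \<longlonglongrightarrow> 0"
proof -
  note [measurable] = y(1)
  define g where "g x = lim (\<lambda>n. gain (y n) x)" for x
  have g_lim: "(\<lambda>n. gain (y n) x) \<longlonglongrightarrow> g x" if "x \<in> space M" for x
    using conv[OF that] by (simp add: g_def convergent_LIMSEQ_iff)
  have [measurable]: "gain (y n) \<in> borel_measurable M" "generator (y n) \<in> borel_measurable M" for n
    using square_integrable_operators[OF y(1)[of n]] by measurable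
  have [measurable]: "row_sum \<in> borel_measurable M"
    by (rule measurable_operators(4)[of "\<lambda>_. 0"]) simp
  have [measurable]: "g \<in> borel_measurable M"
    by (rule borel_measurable_LIMSEQ_real[OF g_lim]) measurable
  have g_bound: "\<bar>g x\<bar> \<le> C" if "x \<in> space M" for x
    using abs_gain_le_unit[OF y that] by (intro LIMSEQ_le_const2[OF tendsto_rabs[OF g_lim[OF that]]]) auto
  \<comment> \<open>The candidate limit: if K y_n - S y_n tends to 0 and K y_n tends to g, then y_n
    tends to g / S, which is bounded because S \<ge> \<delta>.\<close>
  define z where "z x = g x / row_sum x" for x
  have [measurable]: "z \<in> borel_measurable M" unfolding z_def by measurable
  have z_bound: "AE x in M. \<bar>z x\<bar> \<le> C / \<delta>"
    using row_sum_ge' AE_space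
  proof eventually_elim
    case (elim x)
    then show ?case
      using g_bound[of x] \<delta>_pos by (auto simp: z_def intro!: frac_le)
  qed
  have z: "square_integrable M z"
    by (rule square_integrable_bounded[OF _ z_bound]) measurable
  define E where "E n = (\<integral>x. v x * (z x - y n x)\<^sup>2 \<partial>M)" for n
  have zy: "square_integrable M (\<lambda>x. z x - y n x)" for n
    by (intro square_integrable_diff z y)
  have E_nonneg: "0 \<le> E n" for n
    unfolding E_def by (rule integral_v_power2_nonneg)
  define F where "F n = (\<integral>x. v x * (gain (y n) x - g x)\<^sup>2 \<partial>M)" for n
  have gg: "square_integrable M g"
    using g_bound by (intro square_integrable_bounded[of _ C]) auto
  have gain_g: "square_integrable M (\<lambda>x. gain (y n) x - g x)" for n
    by (intro square_integrable_diff gg square_integrable_operators y)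
  have F_lim: "F \<longlonglongrightarrow> 0"
  proof -
    have "(\<lambda>n. \<integral>x. v x * (gain (y n) x - g x)\<^sup>2 \<partial>M) \<longlonglongrightarrow> (\<integral>x. 0 \<partial>M)"
    proof (rule integral_dominated_convergence)
      show "integrable M (\<lambda>x. (2 * C)\<^sup>2 * v x)"
        using square_integrable_integrable[OF v_L2] by simp
      show "AE x in M. (\<lambda>n. v x * (gain (y n) x - g x)\<^sup>2) \<longlonglongrightarrow> 0"
      proof (rule AE_I2)
        fix x assume "x \<in> space M"
        have "(\<lambda>n. v x * (gain (y n) x - g x)\<^sup>2) \<longlonglongrightarrow> v x * (g x - g x)\<^sup>2"
          by (intro tendsto_intros g_lim) fact
        then show "(\<lambda>n. v x * (gain (y n) x - g x)\<^sup>2) \<longlonglongrightarrow> 0" by simp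
      qed
      fix n
      show "AE x in M. norm (v x * (gain (y n) x - g x)\<^sup>2) \<le> (2 * C)\<^sup>2 * v x"
        using v_pos AE_space
      proof eventually_elim
        case (elim x)
        have "\<bar>gain (y n) x - g x\<bar> \<le> \<bar>2 * C\<bar>"
          using g_bound[of x] abs_gain_le_unit[OF y, of x n] elim by simp
        then have "(gain (y n) x - g x)\<^sup>2 \<le> (2 * C)\<^sup>2"
          by (simp only: abs_le_square_iff)
        then have "v x * (gain (y n) x - g x)\<^sup>2 \<le> v x * (2 * C)\<^sup>2"
          using elim by (intro mult_left_mono) auto
        then show ?case using elim by (simp add: mult.commute)
      qed
    qed measurable
    then show ?thesis unfolding F_def by simp
  qed
  \<comment> \<open>S (z - y_n) = A y_n - (K y_n - g) and S \<ge> \<delta>. The first term is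
    controlled by \<open>weighted_generator_le\<close>, the second is \<open>F n\<close>.\<close>
  have E_le: "E n \<le> (2 / \<delta>\<^sup>2) * (C * dissipation (y n) + F n)" for n
  proof -
    have int: "integrable M (\<lambda>x. v x * (generator (y n) x)\<^sup>2)" "integrable M (\<lambda>x. v x * (gain (y n) x - g x)\<^sup>2)"
      by (intro integrable_v_power2 gain_g square_integrable_operators y)+
    have "E n \<le> (\<integral>x. (2 / \<delta>\<^sup>2) * (v x * (generator (y n) x)\<^sup>2 + v x * (gain (y n) x - g x)\<^sup>2) \<partial>M)"
      unfolding E_def
    proof (rule integral_mono_AE)
      show "AE x in M. v x * (z x - y n x)\<^sup>2
          \<le> (2 / \<delta>\<^sup>2) * (v x * (generator (y n) x)\<^sup>2 + v x * (gain (y n) x - g x)\<^sup>2)"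
        using v_pos AE_space row_sum_ge'
      proof eventually_elim
        case (elim x)
        let ?a = "generator (y n) x" and ?b = "gain (y n) x - g x"
        have "row_sum x * (z x - y n x) = ?a - ?b"
          using elim \<delta>_pos generator_eq[OF square_integrable_integrable[OF y(1)[of n]], of x]
          by (simp add: z_def algebra_simps)
        then have "(row_sum x)\<^sup>2 * (z x - y n x)\<^sup>2 = (?a - ?b)\<^sup>2"
          by (metis power_mult_distrib)
        also have "\<dots> \<le> 2 * (?a\<^sup>2 + ?b\<^sup>2)"
          using zero_le_power2[of "?a + ?b"] by (simp add: power2_eq_square algebra_simps)
        finally have "\<delta>\<^sup>2 * (z x - y n x)\<^sup>2 \<le> 2 * (?a\<^sup>2 + ?b\<^sup>2)"
          using elim \<delta>_pos mult_right_mono[OF power_mono[of \<delta> "row_sum x" 2], of "(z x - y n x)\<^sup>2"] by simp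
        then have "(z x - y n x)\<^sup>2 \<le> (2 / \<delta>\<^sup>2) * (?a\<^sup>2 + ?b\<^sup>2)"
          using \<delta>_pos by (simp add: field_simps)
        then have "v x * (z x - y n x)\<^sup>2 \<le> v x * ((2 / \<delta>\<^sup>2) * (?a\<^sup>2 + ?b\<^sup>2))"
          using elim by (intro mult_left_mono) auto
        then show ?case by (simp add: algebra_simps)
      qed
    qed (use int in \<open>auto intro: integrable_v_power2 zy\<close>)
    also have "\<dots> = (2 / \<delta>\<^sup>2) * ((\<integral>x. v x * (generator (y n) x)\<^sup>2 \<partial>M) + F n)"
      using int by (simp add: F_def)
    also have "\<dots> \<le> (2 / \<delta>\<^sup>2) * (C * dissipation (y n) + F n)"
      using weighted_generator_le[OF y(1)] by (intro mult_left_mono add_right_mono) auto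
    finally show ?thesis .
  qed
  have E_lim: "E \<longlonglongrightarrow> 0"
  proof (rule tendsto_sandwich[OF _ _ tendsto_const])
    show "(\<lambda>n. (2 / \<delta>\<^sup>2) * (C * dissipation (y n) + F n)) \<longlonglongrightarrow> 0"
      by (rule tendsto_eq_intros D F_lim refl | simp)+
  qed (rule always_eventually allI E_nonneg E_le)+
  \<comment> \<open>Write z as y_n plus z - y_n; by \<open>dissipation_add_le\<close> and
    \<open>dissipation_le\<close> the second part costs 2 * 4 C times \<open>E n\<close>.\<close>
  have "dissipation z \<le> 0"
  proof (rule LIMSEQ_le_const)
    show "(\<lambda>n. 2 * dissipation (y n) + 8 * C * E n) \<longlonglongrightarrow> 0"
      by (rule tendsto_eq_intros D E_lim refl | simp)+
    have "dissipation z \<le> 2 * dissipation (y n) + 8 * C * E n" for n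
      using dissipation_add_le[OF y(1)[of n] zy[of n]] dissipation_le[OF zy[of n]]
      by (simp add: E_def)
    then show "\<exists>N. \<forall>n\<ge>N. dissipation z \<le> 2 * dissipation (y n) + 8 * C * E n" by blast
  qed
  then have "dissipation z = 0"
    using dissipation_nonneg[of z] by simp
  note z_const = dissipation_eq_0D[OF z this]
  \<comment> \<open>The weighted means of y_n vanish, so that of z equals that of z - y_n. As v^2
    \<le> (C / \<delta>) v, its square is bounded by a multiple of \<open>E n\<close>.\<close>
  have "(\<integral>x. z x * v x \<partial>M)\<^sup>2 \<le> 0"
  proof (rule LIMSEQ_le_const)
    show "(\<lambda>n. (C / \<delta>) * E n) \<longlonglongrightarrow> 0"
      by (rule tendsto_eq_intros E_lim refl | simp)+
    have "(\<integral>x. z x * v x \<partial>M)\<^sup>2 \<le> (C / \<delta>) * E n" for n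
    proof -
      let ?d = "\<lambda>x. v x * (z x - y n x)"
      have d: "square_integrable M ?d"
        by (rule square_integrable_v_mult[OF zy])
      have "(\<integral>x. ?d x \<partial>M) = (\<integral>x. z x * v x - y n x * v x \<partial>M)"
        by (simp add: algebra_simps)
      also have "\<dots> = (\<integral>x. z x * v x \<partial>M)"
        using square_integrable_mult[OF z v_L2] square_integrable_mult[OF y(1)[of n] v_L2] mean[of n] by simp
      finally have "(\<integral>x. z x * v x \<partial>M)\<^sup>2 = \<bar>\<integral>x. ?d x \<partial>M\<bar>\<^sup>2" by simp
      also have "\<dots> \<le> (\<integral>x. \<bar>?d x\<bar> \<partial>M)\<^sup>2"
        by (intro power_mono integral_abs_bound) simp
      also have "\<dots> \<le> (\<integral>x. (?d x)\<^sup>2 \<partial>M)"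
        by (rule square_integral_le[OF d])
      also have "\<dots> \<le> (\<integral>x. (C / \<delta>) * (v x * (z x - y n x)\<^sup>2) \<partial>M)"
      proof (rule integral_mono_AE)
        show "AE x in M. (v x * (z x - y n x))\<^sup>2 \<le> (C / \<delta>) * (v x * (z x - y n x)\<^sup>2)"
          using v_pos v_bounded
        proof eventually_elim
          case (elim x)
          have "v x * (v x * (z x - y n x)\<^sup>2) \<le> (C / \<delta>) * (v x * (z x - y n x)\<^sup>2)"
            using elim by (intro mult_right_mono) auto
          then show ?case by (simp add: power2_eq_square mult_ac)
        qed
        show "integrable M (\<lambda>x. (C / \<delta>) * (v x * (z x - y n x)\<^sup>2))"
          by (intro integrable_mult_right integrable_v_power2 zy)
      qed (rule square_integrable_power2[OF d])
      finally show ?thesis by (simp add: E_def)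
    qed
    then show "\<exists>N. \<forall>n\<ge>N. (\<integral>x. z x * v x \<partial>M)\<^sup>2 \<le> (C / \<delta>) * E n" by blast
  qed
  then have "(\<integral>x. z x * v x \<partial>M) = 0" by simp
  \<comment> \<open>Now z = g / S is 0 almost everywhere, and so is g because S \<ge> \<delta> >
    0.\<close>
  with z_const have g0: "AE x in M. g x = 0"
    using row_sum_ge' by (auto elim!: eventually_elim2 simp: z_def) (use \<delta>_pos in auto)
  have "(\<lambda>n. \<integral>x. (gain (y n) x)\<^sup>2 \<partial>M) \<longlonglongrightarrow> (\<integral>x. 0 \<partial>M)"
  proof (rule integral_dominated_convergence)
    show "integrable M (\<lambda>x. C\<^sup>2)" by simp
    show "AE x in M. (\<lambda>n. (gain (y n) x)\<^sup>2) \<longlonglongrightarrow> 0"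
      using g0 AE_space
    proof eventually_elim
      case (elim x)
      then show ?case using tendsto_power[OF g_lim, of x 2] by simp
    qed
    show "AE x in M. norm ((gain (y n) x)\<^sup>2) \<le> C\<^sup>2" for n
      using abs_gain_le_unit[OF y] C_nonneg by (auto simp: abs_le_square_iff[symmetric])
  qed measurable
  then show ?thesis by simp
qed

theorem spectral_gap:
  obtains B c where "0 \<le> B" "0 < c"
    "\<And>z. square_integrable M z \<Longrightarrow> (\<integral>x. z x * v x \<partial>M) = 0 \<Longrightarrow>
      (\<integral>x. z x * generator z x \<partial>M) - B * dissipation z \<le> - c * (\<integral>x. (z x)\<^sup>2 \<partial>M)"
proof -
  have "\<exists>B c. 0 \<le> B \<and> 0 < c \<and> (\<forall>z. square_integrable M z \<longrightarrow> (\<integral>x. z x * v x \<partial>M) = 0 \<longrightarrow>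
      (\<integral>x. z x * generator z x \<partial>M) - B * dissipation z \<le> - c * (\<integral>x. (z x)\<^sup>2 \<partial>M))" (is "\<exists>B c. ?P B c")
  proof (rule ccontr)
    assume "\<nexists>B c. ?P B c"
    \<comment> \<open>Deny the claim for B = n and c = 1 / (n + 1); the shift keeps c meaningful at
      n = 0.\<close>
    then have neg: "\<not> ?P (real n) (1 / real (Suc n))" for n by blast
    define Q where "Q n z \<longleftrightarrow> square_integrable M z \<and> (\<integral>x. (z x)\<^sup>2 \<partial>M) = 1 \<and> (\<integral>x. z x * v x \<partial>M) = 0 \<and>
      (\<integral>x. z x * generator z x \<partial>M) - real n * dissipation z > - (1 / real (Suc n))" for n z
    have "\<forall>n. \<exists>z. Q n z"
    proof
      fix n
      from neg[of n] obtain u where u: "square_integrable M u" "(\<integral>x. u x * v x \<partial>M) = 0"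
        "(\<integral>x. u x * generator u x \<partial>M) - real n * dissipation u > - (1 / real (Suc n)) * (\<integral>x. (u x)\<^sup>2 \<partial>M)"
        by (auto simp: not_le)
      define N where "N = (\<integral>x. (u x)\<^sup>2 \<partial>M)"
      \<comment> \<open>For u = 0 almost everywhere the strict violation would make the dissipation
        negative. So u can be scaled to norm 1.\<close>
      have "N \<noteq> 0"
      proof
        assume "N = 0"
        then have "AE x in M. (u x)\<^sup>2 = 0"
          using integral_nonneg_eq_0_iff_AE[OF square_integrable_power2[OF u(1)]] by (simp add: N_def)
        then have "(\<integral>x. u x * generator u x \<partial>M) = 0"
          by (intro integral_eq_zero_AE) (auto elim!: eventually_mono)
        with u(3) \<open>N = 0\<close> have "real n * dissipation u < 0" by (simp add: N_def)
        then show False using dissipation_nonneg[of u] by (simp add: mult_less_0_iff)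
      qed
      then have N: "N > 0" by (simp add: N_def less_le)
      define a where "a = 1 / sqrt N"
      have a2: "a\<^sup>2 = 1 / N" using N by (simp add: a_def power_divide)
      let ?z = "\<lambda>x. a * u x"
      have "(\<integral>x. ?z x * generator ?z x \<partial>M) = (\<integral>x. a\<^sup>2 * (u x * generator u x) \<partial>M)"
        unfolding generator_cmult by (simp add: power2_eq_square mult_ac)
      then have e: "(\<integral>x. ?z x * generator ?z x \<partial>M) - real n * dissipation ?z
          = (1 / N) * ((\<integral>x. u x * generator u x \<partial>M) - real n * dissipation u)"
        by (simp add: dissipation_cmult a2 right_diff_distrib)
      have "(1 / N) * (- (1 / real (Suc n)) * N) < (1 / N) * ((\<integral>x. u x * generator u x \<partial>M) - real n * dissipation u)"
        using u(3) N by (intro mult_strict_left_mono) (simp_all add: N_def)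
      then have "- (1 / real (Suc n)) < (\<integral>x. ?z x * generator ?z x \<partial>M) - real n * dissipation ?z"
        unfolding e using N by simp
      moreover have "(\<integral>x. (?z x)\<^sup>2 \<partial>M) = 1"
        using N by (simp add: power_mult_distrib a2 N_def)
      moreover have "(\<integral>x. ?z x * v x \<partial>M) = 0"
        using u(2) by (simp add: mult.assoc)
      moreover have "square_integrable M ?z" by (rule square_integrable_cmult[OF u(1)])
      ultimately show "\<exists>z. Q n z" unfolding Q_def by blast
    qed
    then have "\<exists>z. \<forall>n. Q n (z n)" by (rule choice)
    then obtain z where "Q n (z n)" for n by blast
    then have z: "square_integrable M (z n)" "(\<integral>x. (z n x)\<^sup>2 \<partial>M) = 1"
        "(\<integral>x. z n x * v x \<partial>M) = 0"
        "(\<integral>x. z n x * generator (z n) x \<partial>M) - real n * dissipation (z n) > - (1 / real (Suc n))" for n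
      unfolding Q_def by blast+
    have z1: "(\<integral>x. (z n x)\<^sup>2 \<partial>M) \<le> 1" for n by (simp add: z)
    \<comment> \<open>The violated inequality with <z, A z> = <z, K z> - <z, S z>, where <z, S z> is
      at least \<delta> and <z, K z> at most the norm of K z.\<close>
    have key: "\<delta> + real n * dissipation (z n) \<le> sqrt (\<integral>x. (gain (z n) x)\<^sup>2 \<partial>M) + 1 / real (Suc n)" for n
      using z(4)[of n] energy_eq[OF z(1)[of n]] row_sum_energy_ge[OF z(1)[of n]] gain_energy_le[OF z(1) z1, of n] z(2)[of n]
      by simp
    have D_lim: "(\<lambda>n. dissipation (z n)) \<longlonglongrightarrow> 0"
    proof (rule tendsto_sandwich[OF _ _ tendsto_const])
      \<comment> \<open>The right side of \<open>key\<close> is at most C + 1, so the penalty n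
        D(z_n) stays bounded.\<close>
      have "dissipation (z n) \<le> (C + 1) / real n" if "n > 0" for n
      proof -
        have "sqrt (\<integral>x. (gain (z n) x)\<^sup>2 \<partial>M) \<le> C"
          using real_sqrt_le_mono[OF gain_power2_integral_le[OF z(1) z1, of n]] C_nonneg by simp
        moreover have "1 / real (Suc n) \<le> 1" by simp
        ultimately have "real n * dissipation (z n) \<le> C + 1"
          using key[of n] \<delta>_pos by linarith
        then show ?thesis using that by (simp add: field_simps)
      qed
      then show "\<forall>\<^sub>F n in sequentially. dissipation (z n) \<le> (C + 1) / real n"
        by (auto intro: eventually_mono[OF eventually_gt_at_top[of 0]])
      show "(\<lambda>n. (C + 1) / real n) \<longlonglongrightarrow> 0"
        by (rule lim_const_over_n)
    qed (simp add: dissipation_nonneg)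
    obtain r where r: "strict_mono r" "\<And>x. x \<in> space M \<Longrightarrow> convergent (\<lambda>n. gain (z (r n)) x)"
      using gain_compact[of z, OF z(1) z1] by (auto simp: gain_def)
    have gain_lim: "(\<lambda>n. \<integral>x. (gain (z (r n)) x)\<^sup>2 \<partial>M) \<longlonglongrightarrow> 0"
      using LIMSEQ_subseq_LIMSEQ[OF D_lim r(1)]
      by (intro vanishing_dissipation_imp_vanishing_gain z z1 r(2)) (simp_all add: o_def)
    \<comment> \<open>Drop the nonnegative penalty in \<open>key\<close> and pass to the limit along
      r.\<close>
    have "\<delta> \<le> 0"
    proof (rule LIMSEQ_le_const)
      have "(\<lambda>n. 1 / real (Suc (r n))) \<longlonglongrightarrow> 0"
        using LIMSEQ_subseq_LIMSEQ[OF LIMSEQ_inverse_real_of_nat r(1)] by (simp add: o_def inverse_eq_divide)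
      then show "(\<lambda>n. sqrt (\<integral>x. (gain (z (r n)) x)\<^sup>2 \<partial>M) + 1 / real (Suc (r n))) \<longlonglongrightarrow> 0"
        using tendsto_add[OF tendsto_real_sqrt[OF gain_lim]] by fastforce
      have "\<delta> \<le> sqrt (\<integral>x. (gain (z (r n)) x)\<^sup>2 \<partial>M) + 1 / real (Suc (r n))" for n
        using key[of "r n"] mult_nonneg_nonneg[OF of_nat_0_le_iff[of "r n"] dissipation_nonneg[of "z (r n)"]] by linarith
      then show "\<exists>N. \<forall>n\<ge>N. \<delta> \<le> sqrt (\<integral>x. (gain (z (r n)) x)\<^sup>2 \<partial>M) + 1 / real (Suc (r n))" by blast
    qed
    with \<delta>_pos show False by simp
  qed
  then show ?thesis using that by blast
qed

end
section \<open>Evolution equations in the space of square-integrable functions\<close>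

text \<open>The convergence in \<open>solves_consensus_L2\<close>, with squared norms and over an
  arbitrary measure.\<close>

definition L2_derivative :: "'a measure \<Rightarrow> (real \<Rightarrow> 'a \<Rightarrow> real) \<Rightarrow> ('a \<Rightarrow> real) \<Rightarrow> real \<Rightarrow> bool" where
  "L2_derivative M y a t \<longleftrightarrow>
     ((\<lambda>s. \<integral>x. ((y s x - y t x) / (s - t) - a x)\<^sup>2 \<partial>M) \<longlongrightarrow> 0) (at t within {0..})"

text \<open>The remainder r of the difference quotient tends to 0 in L^2, and Cauchy-Schwarz bounds
  its product with f.\<close>

lemma L2_derivative_inner:
  assumes y: "\<And>s. s \<ge> 0 \<Longrightarrow> square_integrable M (y s)" and a: "square_integrable M a"
    and f: "square_integrable M f" and t: "t \<ge> 0" and der: "L2_derivative M y a t"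
  shows "((\<lambda>s. \<integral>x. y s x * f x \<partial>M) has_real_derivative (\<integral>x. a x * f x \<partial>M)) (at t within {0..})"
proof -
  define r where "r s x = (y s x - y t x) / (s - t) - a x" for s x
  define R where "R s = (\<integral>x. (r s x)\<^sup>2 \<partial>M)" for s
  have R: "(R \<longlongrightarrow> 0) (at t within {0..})"
    using der by (simp add: L2_derivative_def R_def[abs_def] r_def)
  have r_L2: "square_integrable M (r s)" if "s \<ge> 0" for s
    using square_integrable_diff[OF square_integrable_cmult[OF square_integrable_diff[OF y[OF that] y[OF t]], of "1 / (s - t)"] a]
    by (simp add: r_def[abs_def])
  define q where "q s = (\<integral>x. y s x * f x \<partial>M)" for s
  define F where "F = (\<integral>x. (f x)\<^sup>2 \<partial>M)"
  have "((\<lambda>s. (q s - q t) / (s - t) - (\<integral>x. a x * f x \<partial>M)) \<longlongrightarrow> 0) (at t within {0..})"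
  proof (rule Lim_null_comparison)
    have "norm ((q s - q t) / (s - t) - (\<integral>x. a x * f x \<partial>M)) \<le> sqrt (R s * F)" if s: "s \<ge> 0" "s \<noteq> t" for s
    proof -
      have "y s x * f x = y t x * f x + (s - t) * (a x * f x + r s x * f x)" for x
        using s(2) by (simp add: r_def field_simps)
      then have "q s = q t + (s - t) * ((\<integral>x. a x * f x \<partial>M) + (\<integral>x. r s x * f x \<partial>M))"
        using square_integrable_mult[OF y[OF t] f] square_integrable_mult[OF a f]
          square_integrable_mult[OF r_L2[OF s(1)] f]
        by (simp add: q_def)
      then have "(q s - q t) / (s - t) - (\<integral>x. a x * f x \<partial>M) = (\<integral>x. r s x * f x \<partial>M)"
        using s(2) by simp
      moreover have "\<bar>\<integral>x. r s x * f x \<partial>M\<bar> \<le> sqrt (R s * F)"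
        using Cauchy_Schwarz_integral[OF r_L2[OF s(1)] f] by (intro real_le_rsqrt) (simp add: R_def F_def)
      ultimately show ?thesis by simp
    qed
    then show "\<forall>\<^sub>F s in at t within {0..}. norm ((q s - q t) / (s - t) - (\<integral>x. a x * f x \<partial>M)) \<le> sqrt (R s * F)"
      by (auto simp: eventually_at_filter)
    have "((\<lambda>s. sqrt (R s * F)) \<longlongrightarrow> sqrt (0 * F)) (at t within {0..})"
      by (intro tendsto_intros R)
    then show "((\<lambda>s. sqrt (R s * F)) \<longlongrightarrow> 0) (at t within {0..})" by simp
  qed
  then have "((\<lambda>s. (q s - q t) / (s - t)) \<longlongrightarrow> (\<integral>x. a x * f x \<partial>M)) (at t within {0..})"
    by (simp add: LIM_zero_iff)
  then show ?thesis
    by (simp add: has_field_derivative_iff q_def)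
qed

text \<open>Insert y s = y t + (s - t) (a + r s) and expand. The error consists of a product with r,
  small by Cauchy-Schwarz, and of s - t times a bounded integral; \<open>?bound\<close> collects
  both.\<close>

lemma L2_derivative_weighted_square:
  assumes y: "\<And>s. s \<ge> 0 \<Longrightarrow> square_integrable M (y s)" and a: "square_integrable M a"
    and w [measurable]: "w \<in> borel_measurable M" and w_bound: "AE x in M. \<bar>w x\<bar> \<le> W"
    and t: "t \<ge> 0" and der: "L2_derivative M y a t"
  shows "((\<lambda>s. \<integral>x. w x * (y s x)\<^sup>2 \<partial>M) has_real_derivative 2 * (\<integral>x. w x * (y t x * a x) \<partial>M))
    (at t within {0..})"
proof -
  define r where "r s x = (y s x - y t x) / (s - t) - a x" for s x
  define R where "R s = (\<integral>x. (r s x)\<^sup>2 \<partial>M)" for s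
  have R: "(R \<longlongrightarrow> 0) (at t within {0..})"
    using der by (simp add: L2_derivative_def R_def[abs_def] r_def)
  have r_L2: "square_integrable M (r s)" if "s \<ge> 0" for s
    using square_integrable_diff[OF square_integrable_cmult[OF square_integrable_diff[OF y[OF that] y[OF t]], of "1 / (s - t)"] a]
    by (simp add: r_def[abs_def])
  have wf: "square_integrable M (\<lambda>x. w x * f x)" if "square_integrable M f" for f
    by (rule square_integrable_bounded_mult[OF that w w_bound])
  have prod: "integrable M (\<lambda>x. w x * (f x * g x))" if "square_integrable M f" "square_integrable M g" for f g
    using square_integrable_mult[OF wf[OF that(1)] that(2)] by (simp add: mult.assoc)
  define q where "q s = (\<integral>x. w x * (y s x)\<^sup>2 \<partial>M)" for s
  define Y where "Y = (\<integral>x. (w x * y t x)\<^sup>2 \<partial>M)"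
  define N where "N = (\<integral>x. (a x)\<^sup>2 \<partial>M)"
  let ?D = "2 * (\<integral>x. w x * (y t x * a x) \<partial>M)"
  let ?bound = "\<lambda>s. 2 * sqrt (Y * R s) + \<bar>s - t\<bar> * (W * (2 * N + 2 * R s))"
  have "((\<lambda>s. (q s - q t) / (s - t) - ?D) \<longlongrightarrow> 0) (at t within {0..})"
  proof (rule Lim_null_comparison)
    have "norm ((q s - q t) / (s - t) - ?D) \<le> ?bound s" if s: "s \<ge> 0" "s \<noteq> t" for s
    proof -
      note rs = r_L2[OF s(1)]
      let ?b = "\<lambda>x. a x + r s x"
      have b: "square_integrable M ?b"
        by (rule square_integrable_add[OF a rs])
      have "w x * (y s x)\<^sup>2 = w x * (y t x * y t x)
          + (s - t) * (2 * (w x * (y t x * a x)) + 2 * (w x * (y t x * r s x)) + (s - t) * (w x * (?b x * ?b x)))" for x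
      proof -
        have eq: "y s x = y t x + (s - t) * ?b x"
          using s(2) by (simp add: r_def)
        show ?thesis by (subst eq) (simp add: power2_eq_square algebra_simps)
      qed
      then have "q s = q t + (s - t) * (?D + 2 * (\<integral>x. w x * (y t x * r s x) \<partial>M) + (s - t) * (\<integral>x. w x * (?b x * ?b x) \<partial>M))"
        using prod[OF y[OF t] y[OF t]] prod[OF y[OF t] a] prod[OF y[OF t] rs] prod[OF b b]
        by (simp add: q_def power2_eq_square)
      then have "(q s - q t) / (s - t) - ?D
          = 2 * (\<integral>x. w x * (y t x * r s x) \<partial>M) + (s - t) * (\<integral>x. w x * (?b x * ?b x) \<partial>M)"
        using s(2) by simp
      moreover have "\<bar>\<integral>x. w x * (y t x * r s x) \<partial>M\<bar> \<le> sqrt (Y * R s)"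
        using Cauchy_Schwarz_integral[OF wf[OF y[OF t]] rs]
        by (intro real_le_rsqrt) (simp add: R_def Y_def mult.assoc)
      moreover have "\<bar>\<integral>x. w x * (?b x * ?b x) \<partial>M\<bar> \<le> W * (2 * N + 2 * R s)"
      proof -
        have "\<bar>\<integral>x. w x * (?b x * ?b x) \<partial>M\<bar> \<le> (\<integral>x. \<bar>w x * (?b x * ?b x)\<bar> \<partial>M)"
          by (rule integral_abs_bound)
        also have "\<dots> \<le> (\<integral>x. W * (2 * (a x)\<^sup>2 + 2 * (r s x)\<^sup>2) \<partial>M)"
        proof (rule integral_mono_AE)
          show "integrable M (\<lambda>x. \<bar>w x * (?b x * ?b x)\<bar>)"
            by (intro integrable_abs prod b)
          show "integrable M (\<lambda>x. W * (2 * (a x)\<^sup>2 + 2 * (r s x)\<^sup>2))"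
            using square_integrable_power2[OF a] square_integrable_power2[OF rs] by simp
          show "AE x in M. \<bar>w x * (?b x * ?b x)\<bar> \<le> W * (2 * (a x)\<^sup>2 + 2 * (r s x)\<^sup>2)"
            using w_bound
          proof eventually_elim
            case (elim x)
            have "?b x * ?b x \<le> 2 * (a x)\<^sup>2 + 2 * (r s x)\<^sup>2"
              using zero_le_power2[of "a x - r s x"] by (simp add: power2_eq_square algebra_simps)
            then have "\<bar>w x\<bar> * (?b x * ?b x) \<le> W * (2 * (a x)\<^sup>2 + 2 * (r s x)\<^sup>2)"
              using elim by (intro mult_mono) auto
            then show ?case by (simp add: abs_mult)
          qed
        qed
        also have "\<dots> = W * (2 * N + 2 * R s)"
          using square_integrable_power2[OF a] square_integrable_power2[OF rs] by (simp add: N_def R_def)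
        finally show ?thesis .
      qed
      then have "\<bar>(s - t) * (\<integral>x. w x * (?b x * ?b x) \<partial>M)\<bar> \<le> \<bar>s - t\<bar> * (W * (2 * N + 2 * R s))"
        unfolding abs_mult by (intro mult_left_mono) auto
      ultimately show ?thesis unfolding real_norm_def by linarith
    qed
    then show "\<forall>\<^sub>F s in at t within {0..}. norm ((q s - q t) / (s - t) - ?D) \<le> ?bound s"
      by (auto simp: eventually_at_filter)
    have "(?bound \<longlongrightarrow> 2 * sqrt (Y * 0) + \<bar>t - t\<bar> * (W * (2 * N + 2 * 0))) (at t within {0..})"
      by (intro tendsto_intros R)
    then show "(?bound \<longlongrightarrow> 0) (at t within {0..})" by simp
  qed
  then have "((\<lambda>s. (q s - q t) / (s - t)) \<longlongrightarrow> ?D) (at t within {0..})"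
    by (simp add: LIM_zero_iff)
  then show ?thesis
    by (simp add: has_field_derivative_iff q_def)
qed

section \<open>Lyapunov functional and exponential convergence\<close>

context interaction_kernel
begin

theorem exponential_convergence:
  obtains \<rho> K where "\<rho> > 0" "K > 0"
    "\<forall>y. (\<forall>t\<ge>0. square_integrable M (y t) \<and> L2_derivative M y (generator (y t)) t) \<longrightarrow>
      (\<forall>t\<ge>0. (\<integral>x. (y t x - (\<integral>x. y t x * v x \<partial>M))\<^sup>2 \<partial>M)
        \<le> K * (\<integral>x. (y 0 x - (\<integral>x. y t x * v x \<partial>M))\<^sup>2 \<partial>M) * exp (- \<rho> * t))"
proof -
  obtain B c where B: "0 \<le> B" and c: "0 < c" and gap:
    "\<And>z. square_integrable M z \<Longrightarrow> (\<integral>x. z x * v x \<partial>M) = 0 \<Longrightarrow>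
      (\<integral>x. z x * generator z x \<partial>M) - B * dissipation z \<le> - c * (\<integral>x. (z x)\<^sup>2 \<partial>M)"
    using spectral_gap by blast
  \<comment> \<open>With the coefficient \<open>2 * B\<close>,
    \<open>weighted_energy_identity\<close> turns half the derivative of the w-weighted energy into
    the left side of \<open>gap\<close>.\<close>
  define w where "w x = 1 + 2 * B * v x" for x
  define W where "W = 1 + 2 * B * (C / \<delta>)"
  have [measurable]: "w \<in> borel_measurable M" unfolding w_def by measurable
  have W: "W > 0" using B C_nonneg \<delta>_pos by (simp add: W_def add_pos_nonneg)
  have w_bounds: "AE x in M. 1 \<le> w x \<and> w x \<le> W"
    using v_pos v_bounded
  proof eventually_elim
    case (elim x)
    then show ?case using B by (simp add: w_def W_def mult_left_mono flip: times_divide_eq_right)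
  qed
  then have w_abs: "AE x in M. \<bar>w x\<bar> \<le> W" by (rule eventually_mono) simp
  \<comment> \<open>The rate results from q' \<le> - 2 c |z|^2 and |z|^2 \<ge> q / W.\<close>
  have "2 * c / W > 0" "W > 0" using c W by simp_all
  then show ?thesis
  proof (rule that, intro allI impI)
    fix y :: "real \<Rightarrow> 'a \<Rightarrow> real" and t :: real
    assume sol': "\<forall>t\<ge>0. square_integrable M (y t) \<and> L2_derivative M y (generator (y t)) t" and t: "t \<ge> 0"
    have sol: "square_integrable M (y t)" "L2_derivative M y (generator (y t)) t" if "t \<ge> 0" for t
      using sol' that by blast+
    note y = sol(1)
    have "\<exists>m. \<forall>s\<in>{0..}. (\<integral>x. y s x * v x \<partial>M) = m"
    proof (rule has_field_derivative_zero_constant)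
      fix s :: real assume "s \<in> {0..}"
      then have s: "s \<ge> 0" by simp
      show "((\<lambda>s. \<integral>x. y s x * v x \<partial>M) has_real_derivative 0) (at s within {0..})"
        using L2_derivative_inner[OF y square_integrable_operators(4)[OF y[OF s]] v_L2 s] sol[OF s]
          v_adjoint_kernel[OF y[OF s]]
        by (simp add: generator_def)
    qed simp
    then obtain m where m: "\<And>s. s \<ge> 0 \<Longrightarrow> (\<integral>x. y s x * v x \<partial>M) = m" by auto
    define z where "z s x = y s x - m" for s x
    have z: "square_integrable M (z s)" if "s \<ge> 0" for s
      unfolding z_def by (intro square_integrable_diff y that square_integrable_bounded[of _ "\<bar>m\<bar>"]) auto
    have z_gen: "generator (z s) = generator (y s)" for s
      by (simp add: z_def generator_def fun_eq_iff)
    have z_der: "L2_derivative M z (generator (z s)) s" if "s \<ge> 0" for s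
      using sol[OF that] unfolding L2_derivative_def z_gen by (simp add: z_def)
    have z_mean: "(\<integral>x. z s x * v x \<partial>M) = 0" if "s \<ge> 0" for s
    proof -
      have "(\<integral>x. z s x * v x \<partial>M) = (\<integral>x. y s x * v x - m * v x \<partial>M)"
        by (simp add: z_def algebra_simps)
      also have "\<dots> = 0"
        using square_integrable_mult[OF y[OF that] v_L2] square_integrable_integrable[OF v_L2] m[OF that] v_mass
        by simp
      finally show ?thesis .
    qed
    define q where "q s = (\<integral>x. w x * (z s x)\<^sup>2 \<partial>M)" for s
    have w_int: "integrable M (\<lambda>x. w x * (f x * g x))" if "square_integrable M f" "square_integrable M g" for f g
      using square_integrable_mult[OF square_integrable_bounded_mult[OF that(1) _ w_abs] that(2)] by (simp add: mult.assoc)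
    have q_lower: "(\<integral>x. (z s x)\<^sup>2 \<partial>M) \<le> q s" and q_upper: "q s \<le> W * (\<integral>x. (z s x)\<^sup>2 \<partial>M)" if s: "s \<ge> 0" for s
    proof -
      note i = square_integrable_power2[OF z[OF s]] w_int[OF z[OF s] z[OF s]]
      show "(\<integral>x. (z s x)\<^sup>2 \<partial>M) \<le> q s"
        unfolding q_def
      proof (rule integral_mono_AE)
        show "AE x in M. (z s x)\<^sup>2 \<le> w x * (z s x)\<^sup>2"
          using w_bounds
        proof eventually_elim
          case (elim x)
          then show ?case using mult_right_mono[of 1 "w x" "(z s x)\<^sup>2"] by simp
        qed
      qed (use i in \<open>simp_all add: power2_eq_square\<close>)
      have "q s \<le> (\<integral>x. W * (z s x)\<^sup>2 \<partial>M)"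
        unfolding q_def
      proof (rule integral_mono_AE)
        show "AE x in M. w x * (z s x)\<^sup>2 \<le> W * (z s x)\<^sup>2"
          using w_bounds by eventually_elim (simp add: mult_right_mono)
      qed (use i in \<open>simp_all add: power2_eq_square\<close>)
      then show "q s \<le> W * (\<integral>x. (z s x)\<^sup>2 \<partial>M)" by simp
    qed
    have "q t \<le> q 0 * exp (- (2 * c / W) * t)"
    proof (rule exponential_decay[OF _ _ t])
      fix s :: real assume s: "s \<ge> 0"
      let ?A = "generator (z s)"
      note A = square_integrable_operators(4)[OF z[OF s]]
      show "(q has_real_derivative 2 * (\<integral>x. w x * (z s x * ?A x) \<partial>M)) (at s within {0..})"
        using L2_derivative_weighted_square[OF z A _ w_abs s z_der[OF s]] by (simp add: q_def[abs_def])
      have "(\<integral>x. w x * (z s x * ?A x) \<partial>M) = (\<integral>x. z s x * ?A x + B * (2 * (v x * z s x * ?A x)) \<partial>M)"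
        by (simp add: w_def algebra_simps)
      also have "\<dots> = (\<integral>x. z s x * ?A x \<partial>M) + B * (2 * (\<integral>x. v x * z s x * ?A x \<partial>M))"
        using square_integrable_mult[OF z[OF s] A] square_integrable_mult[OF square_integrable_v_mult[OF z[OF s]] A]
        by simp
      also have "\<dots> = (\<integral>x. z s x * ?A x \<partial>M) - B * dissipation (z s)"
        unfolding weighted_energy_identity[OF z[OF s]] by simp
      also have "\<dots> \<le> - c * (\<integral>x. (z s x)\<^sup>2 \<partial>M)"
        by (rule gap[OF z[OF s] z_mean[OF s]])
      finally have "2 * (\<integral>x. w x * (z s x * ?A x) \<partial>M) \<le> - (2 * c) * (\<integral>x. (z s x)\<^sup>2 \<partial>M)" by simp
      also have "\<dots> \<le> - (2 * c / W) * q s"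
        using q_upper[OF s] c W by (simp add: field_simps)
      finally show "2 * (\<integral>x. w x * (z s x * ?A x) \<partial>M) \<le> - (2 * c / W) * q s" .
    qed
    also have "\<dots> \<le> W * (\<integral>x. (z 0 x)\<^sup>2 \<partial>M) * exp (- (2 * c / W) * t)"
      by (intro mult_right_mono q_upper) auto
    finally show "(\<integral>x. (y t x - (\<integral>x. y t x * v x \<partial>M))\<^sup>2 \<partial>M)
        \<le> W * (\<integral>x. (y 0 x - (\<integral>x. y t x * v x \<partial>M))\<^sup>2 \<partial>M) * exp (- (2 * c / W) * t)"
      using q_lower[OF t] m[OF t] by (simp add: z_def)
  qed
qed

end

section \<open>Reduction of the infinite-dimensional case to a Borel kernel\<close>

text \<open>Completeness of Lebesgue measure; extension by 0 moves the question to the whole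
  space.\<close>

lemma borel_measurable_lebesgue_on_AE:
  fixes f g :: "'a::euclidean_space \<Rightarrow> real"
  assumes S: "S \<in> sets lebesgue" and f: "f \<in> borel_measurable (lebesgue_on S)"
    and ae: "AE x in lebesgue_on S. f x = g x"
  shows "g \<in> borel_measurable (lebesgue_on S)"
proof -
  have "(\<lambda>x. if x \<in> S then f x else 0) \<in> borel_measurable lebesgue"
    using f S by (simp add: borel_measurable_if)
  moreover have "AE x in lebesgue. (if x \<in> S then f x else 0) = (if x \<in> S then g x else 0)"
    using ae S by (subst (asm) AE_restrict_space_iff) (auto elim!: eventually_mono)
  ultimately have "(\<lambda>x. if x \<in> S then g x else 0) \<in> borel_measurable lebesgue"
    by (rule borel_measurable_AE)
  then show ?thesis
    using S by (simp add: borel_measurable_if)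
qed

text \<open>Fubini for null sets. Lebesgue measure is a completion, so the argument passes to
  \<open>lborel\<close>, where the product formula holds, and back.\<close>

lemma AE_lebesgue_on_Times:
  fixes \<Omega> :: "'a::euclidean_space set"
  assumes \<Omega>: "open \<Omega>" and ae: "AE p in lebesgue_on (\<Omega> \<times> \<Omega>). P (fst p) (snd p)"
  shows "AE x in lebesgue_on \<Omega>. AE y in lebesgue_on \<Omega>. P x y"
proof -
  have \<Omega>2: "\<Omega> \<times> \<Omega> \<in> sets lebesgue" and \<Omega>1: "\<Omega> \<in> sets lebesgue"
    using open_Times[OF \<Omega> \<Omega>] \<Omega> by (simp_all add: borel_open)
  have "AE p in lebesgue. p \<in> \<Omega> \<times> \<Omega> \<longrightarrow> P (fst p) (snd p)"
    using ae \<Omega>2 by (simp add: AE_restrict_space_iff)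
  then have "AE p in lborel \<Otimes>\<^sub>M lborel. p \<in> \<Omega> \<times> \<Omega> \<longrightarrow> P (fst p) (snd p)"
    unfolding AE_completion_iff lborel_prod .
  from lborel_pair.AE_pair[OF this]
  have *: "AE x in lborel. AE y in lborel. x \<in> \<Omega> \<and> y \<in> \<Omega> \<longrightarrow> P x y" by simp
  have "AE x in lebesgue. x \<in> \<Omega> \<longrightarrow> (AE y in lebesgue. y \<in> \<Omega> \<longrightarrow> P x y)"
    using * unfolding AE_completion_iff by eventually_elim auto
  then show ?thesis
    using \<Omega>1 by (simp add: AE_restrict_space_iff)
qed

text \<open>With a Borel representative bounded everywhere, every section \<open>k x\<close> is a
  bounded Borel function and can be tested against weakly Cauchy sequences.\<close>

lemma interaction_function_Borel_representative:
  fixes \<Omega> :: "'a::euclidean_space set"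
  assumes \<Omega>: "open \<Omega>" and \<kappa>: "interaction_function \<Omega> \<kappa>"
  obtains k :: "'a \<Rightarrow> 'a \<Rightarrow> real" and C
  where "case_prod k \<in> borel_measurable borel" "\<And>x y. 0 \<le> k x y" "\<And>x y. k x y \<le> C"
    "AE x in lebesgue_on \<Omega>. AE y in lebesgue_on \<Omega>. \<kappa> x y = k x y"
proof -
  have \<Omega>2: "\<Omega> \<times> \<Omega> \<in> sets lebesgue"
    using open_Times[OF \<Omega> \<Omega>] by (simp add: borel_open)
  let ?N = "lebesgue_on (\<Omega> \<times> \<Omega>)"
  from \<kappa> have meas: "(\<lambda>(x, y). \<kappa> x y) \<in> borel_measurable ?N"
    and sup: "esssup ?N (\<lambda>(x, y). ereal \<bar>\<kappa> x y\<bar>) < \<infinity>"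
    and nonneg: "AE (x, y) in ?N. \<kappa> x y \<ge> 0"
    by (auto simp: interaction_function_def)
  obtain n :: nat where n: "esssup ?N (\<lambda>(x, y). ereal \<bar>\<kappa> x y\<bar>) < ereal (real n)"
    using sup less_PInf_Ex_of_nat by auto
  have bound: "AE p in ?N. \<bar>case_prod \<kappa> p\<bar> \<le> real n"
    using esssup_AE[of "\<lambda>(x, y). ereal \<bar>\<kappa> x y\<bar>" ?N]
  proof eventually_elim
    case (elim p)
    then have "ereal \<bar>case_prod \<kappa> p\<bar> \<le> esssup ?N (\<lambda>(x, y). ereal \<bar>\<kappa> x y\<bar>)"
      by (cases p) simp
    then have "ereal \<bar>case_prod \<kappa> p\<bar> < ereal (real n)"
      using n by (rule order.strict_trans1)
    then show ?case by simp
  qed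
  have "(\<lambda>p. if p \<in> \<Omega> \<times> \<Omega> then case_prod \<kappa> p else 0) \<in> borel_measurable lebesgue"
    using meas \<Omega>2 by (simp add: borel_measurable_if)
  from completion_ex_borel_measurable_real[OF this] obtain h where
    h: "h \<in> borel_measurable lborel" and
    "AE p in lborel. (if p \<in> \<Omega> \<times> \<Omega> then case_prod \<kappa> p else 0) = h p" by blast
  then have "AE p in lebesgue. p \<in> \<Omega> \<times> \<Omega> \<longrightarrow> case_prod \<kappa> p = h p"
    unfolding AE_completion_iff by eventually_elim auto
  then have eq: "AE p in ?N. case_prod \<kappa> p = h p"
    using \<Omega>2 by (simp add: AE_restrict_space_iff)
  \<comment> \<open>By \<open>bound\<close> and \<open>nonneg\<close>, truncation to [0, n] leaves h
    unchanged almost everywhere on the product.\<close>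
  define k where "k x y = max 0 (min (real n) (h (x, y)))" for x y
  show ?thesis
  proof
    have [measurable]: "h \<in> borel_measurable borel" using h by simp
    have "case_prod k = (\<lambda>p. max 0 (min (real n) (h p)))"
      by (auto simp: k_def fun_eq_iff)
    then show "case_prod k \<in> borel_measurable borel" by simp
    show "0 \<le> k x y" "k x y \<le> real n" for x y by (auto simp: k_def)
    have "AE p in ?N. \<kappa> (fst p) (snd p) = k (fst p) (snd p)"
      using eq bound nonneg by eventually_elim (auto simp: k_def)
    then show "AE x in lebesgue_on \<Omega>. AE y in lebesgue_on \<Omega>. \<kappa> x y = k x y"
      by (rule AE_lebesgue_on_Times[OF \<Omega>])
  qed
qed

text \<open>\<kappa> and its Borel representative k define the same operator almost everywhere, so
  \<open>exponential_convergence\<close> carries over; the square root halves the rate.\<close>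

theorem L2_consensus_exponential_decay:
  fixes \<Omega> :: "'a::euclidean_space set"
  assumes \<Omega>: "open \<Omega>" "measure lebesgue \<Omega> = 1" and \<kappa>: "interaction_function \<Omega> \<kappa>"
    and conn: "graph_strongly_connected_L2 \<Omega> \<kappa>" and v: "weight_function \<Omega> \<kappa> v"
  obtains \<rho> K where "\<rho> > 0" "K > 0"
    "\<And>y y0 t. solves_consensus_L2 \<Omega> \<kappa> y \<Longrightarrow> y0 \<in> L2_space \<Omega> \<Longrightarrow> (AE x in lebesgue_on \<Omega>. y 0 x = y0 x) \<Longrightarrow> t \<ge> 0 \<Longrightarrow>
      L2_norm \<Omega> (\<lambda>x. y t x - weighted_mean_L2 \<Omega> v (y t) x)
        \<le> K * L2_norm \<Omega> (\<lambda>x. y0 x - weighted_mean_L2 \<Omega> v (y t) x) * exp (- \<rho> * t)"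
proof -
  let ?M = "lebesgue_on \<Omega>"
  have \<Omega>_sets: "\<Omega> \<in> sets lebesgue" using \<Omega>(1) by (simp add: borel_open)
  \<comment> \<open>\<open>measure\<close> is 0 on sets of infinite measure, which the value 1
    excludes.\<close>
  have "emeasure lebesgue \<Omega> \<noteq> \<infinity>"
    using \<Omega>(2) by (auto simp: measure_def)
  then have "emeasure lebesgue \<Omega> = 1"
    using \<Omega>(2) by (simp add: emeasure_eq_ennreal_measure)
  then interpret prob_space ?M
    using \<Omega>_sets by (intro prob_spaceI) (simp add: emeasure_restrict_space)
  have id_borel [measurable]: "(\<lambda>x. x) \<in> ?M \<rightarrow>\<^sub>M borel"
    by (rule measurable_restrict_space1[OF measurable_completion[OF measurable_ident_sets[OF sets_lborel]]])
  obtain k C where k_borel: "case_prod k \<in> borel_measurable borel"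
    and k_bounds: "\<And>x y. 0 \<le> k x y" "\<And>x y. k x y \<le> C"
    and \<kappa>_eq: "AE x in ?M. AE y in ?M. \<kappa> x y = k x y"
    by (rule interaction_function_Borel_representative[OF \<Omega>(1) \<kappa>]) (rule that)
  have k_section: "k x \<in> borel_measurable borel" for x
    using measurable_compose[OF measurable_Pair1'[of x borel borel] k_borel[folded borel_prod]]
    by simp
  have k_pair [measurable]: "case_prod k \<in> borel_measurable (?M \<Otimes>\<^sub>M ?M)"
  proof -
    have "(\<lambda>p. (fst p, snd p)) \<in> ?M \<Otimes>\<^sub>M ?M \<rightarrow>\<^sub>M borel \<Otimes>\<^sub>M borel"
      by (intro measurable_Pair measurable_compose[OF measurable_fst id_borel]
          measurable_compose[OF measurable_snd id_borel])
    from measurable_compose[OF this k_borel[folded borel_prod]] show ?thesis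
      by (simp add: case_prod_beta')
  qed
  \<comment> \<open>The null set must not depend on f, because the operator uses
    \<open>f y = z y - z x\<close>, which varies with x.\<close>
  have \<kappa>_integral: "AE x in ?M. \<forall>f\<in>borel_measurable ?M. (\<integral>y. \<kappa> x y * f y \<partial>?M) = (\<integral>y. k x y * f y \<partial>?M)"
    using \<kappa>_eq
  proof eventually_elim
    case (elim x)
    have [measurable]: "k x \<in> borel_measurable ?M"
      using measurable_compose[OF id_borel k_section] .
    have [measurable]: "\<kappa> x \<in> borel_measurable ?M"
      using elim by (intro borel_measurable_lebesgue_on_AE[OF \<Omega>_sets, of "k x" "\<kappa> x"]) (auto elim!: eventually_mono)
    show ?case
    proof
      fix f :: "'a \<Rightarrow> real" assume [measurable]: "f \<in> borel_measurable ?M"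
      show "(\<integral>y. \<kappa> x y * f y \<partial>?M) = (\<integral>y. k x y * f y \<partial>?M)"
        using elim by (intro integral_cong_AE) (auto elim!: eventually_mono)
    qed
  qed
  define A where "A z x = (\<integral>y. k x y * (z y - z x) \<partial>?M)" for z x
  have operator_eq: "AE x in ?M. interaction_operator \<Omega> \<kappa> z x = A z x" if [measurable]: "z \<in> borel_measurable ?M" for z
    using \<kappa>_integral by eventually_elim (simp add: interaction_operator_def A_def)
  have A_meas [measurable]: "A z \<in> borel_measurable ?M" if [measurable]: "z \<in> borel_measurable ?M" for z
    unfolding A_def by measurable
  have operator_meas [measurable]: "interaction_operator \<Omega> \<kappa> z \<in> borel_measurable ?M"
    if z: "z \<in> borel_measurable ?M" for z
    using operator_eq[OF z]
    by (intro borel_measurable_lebesgue_on_AE[OF \<Omega>_sets A_meas[OF z]]) (auto elim!: eventually_mono)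
  \<comment> \<open>An equivalence for all w, because uniqueness of v among the positive kernel
    functions of \<kappa> must be passed on to k.\<close>
  have kernel_iff: "positive_kernel_function \<Omega> \<kappa> w \<longleftrightarrow>
      square_integrable ?M w \<and> (AE x in ?M. w x > 0) \<and> (\<integral>x. w x \<partial>?M) = 1 \<and>
      (\<forall>z. square_integrable ?M z \<longrightarrow> (\<integral>x. A z x * w x \<partial>?M) = 0)" for w
  proof -
    have "(\<integral>x. interaction_operator \<Omega> \<kappa> z x * w x \<partial>?M) = (\<integral>x. A z x * w x \<partial>?M)"
      if w: "square_integrable ?M w" and z: "square_integrable ?M z" for z
    proof -
      note [measurable] = w z
      have [measurable]: "z \<in> borel_measurable ?M" by measurable
      show ?thesis
        using operator_eq[of z] by (intro integral_cong_AE) (auto elim!: eventually_mono)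
    qed
    moreover have "square_integrable ?M (\<lambda>_. 0)"
      by (simp add: square_integrable_def)
    ultimately show ?thesis
      by (auto simp: positive_kernel_function_def adjoint_value_def L2_space_iff L2_inner_def)
  qed
  have "essinf ?M (\<lambda>x. ereal (total_influence \<Omega> \<kappa> x)) > 0"
    using conn by (simp add: graph_strongly_connected_L2_def)
  from ereal_dense2[OF this] obtain \<delta> where \<delta>: "0 < \<delta>"
    "ereal \<delta> < essinf ?M (\<lambda>x. ereal (total_influence \<Omega> \<kappa> x))" by (auto simp: zero_ereal_def)
  have row: "AE x in ?M. \<delta> \<le> (\<integral>y. k x y \<partial>?M)"
    using less_LiminfD[OF \<delta>(2)[unfolded essinf_def]] \<kappa>_integral
  proof eventually_elim
    case (elim x)
    then show ?case using bspec[OF elim(2), of "\<lambda>_. 1"] by (simp add: total_influence_def)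
  qed
  interpret interaction_kernel ?M k C \<delta> v
  proof unfold_locales
    have v': "positive_kernel_function \<Omega> \<kappa> v" using v by (simp add: weight_function_def)
    show "square_integrable ?M v" "AE x in ?M. 0 < v x" "(\<integral>x. v x \<partial>?M) = 1"
      "\<And>z. square_integrable ?M z \<Longrightarrow> (\<integral>x. (\<integral>y. k x y * (z y - z x) \<partial>?M) * v x \<partial>?M) = 0"
      using v' unfolding kernel_iff A_def by auto
    show "AE x in ?M. w x = v x"
      if "square_integrable ?M w" "AE x in ?M. 0 < w x" "(\<integral>x. w x \<partial>?M) = 1"
        "\<And>z. square_integrable ?M z \<Longrightarrow> (\<integral>x. (\<integral>y. k x y * (z y - z x) \<partial>?M) * w x \<partial>?M) = 0" for w
      using v that unfolding weight_function_def kernel_iff A_def by blast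
    fix z :: "nat \<Rightarrow> 'a \<Rightarrow> real"
    assume z: "\<And>n. square_integrable ?M (z n)" "\<And>n. (\<integral>x. (z n x)\<^sup>2 \<partial>?M) \<le> 1"
    obtain r where r: "strict_mono r"
      "\<forall>f\<in>borel_measurable borel. \<forall>B. (\<forall>x. \<bar>f x\<bar> \<le> B) \<longrightarrow> convergent (\<lambda>n. \<integral>x. f x * z (r n) x \<partial>?M)"
      by (rule weakly_Cauchy_subsequence[where z = z, OF id_borel z]) (rule that)
    \<comment> \<open>Each section is an admissible test function, so one subsequence serves every
      x.\<close>
    have "convergent (\<lambda>n. \<integral>y. k x y * z (r n) y \<partial>?M)" for x
      using bspec[OF r(2) k_section[of x], THEN spec, of C] k_bounds by simp
    with r(1) show "\<exists>r. strict_mono r \<and> (\<forall>x\<in>space ?M. convergent (\<lambda>n. \<integral>y. k x y * z (r n) y \<partial>?M))" by blast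
  qed (use k_pair k_bounds \<delta>(1) row in auto)
  have A_eq: "A = generator" by (simp add: A_def generator_def fun_eq_iff)
  obtain \<rho> K where \<rho>: "\<rho> > 0" and K: "K > 0" and decay:
    "\<forall>y. (\<forall>t\<ge>0. square_integrable ?M (y t) \<and> L2_derivative ?M y (generator (y t)) t) \<longrightarrow>
      (\<forall>t\<ge>0. (\<integral>x. (y t x - (\<integral>x. y t x * v x \<partial>?M))\<^sup>2 \<partial>?M)
        \<le> K * (\<integral>x. (y 0 x - (\<integral>x. y t x * v x \<partial>?M))\<^sup>2 \<partial>?M) * exp (- \<rho> * t))"
    by (rule exponential_convergence) (rule that)
  have norm_eq: "L2_norm \<Omega> f = sqrt (\<integral>x. (f x)\<^sup>2 \<partial>?M)" for f
    by (simp add: L2_norm_def L2_inner_def power2_eq_square)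
  show ?thesis
  proof
    show "\<rho> / 2 > 0" "sqrt K > 0" using \<rho> K by auto
    fix y :: "real \<Rightarrow> 'a \<Rightarrow> real" and y0 and t :: real
    assume sol: "solves_consensus_L2 \<Omega> \<kappa> y" and y0: "y0 \<in> L2_space \<Omega>"
      and init: "AE x in ?M. y 0 x = y0 x" and t: "t \<ge> 0"
    have y: "square_integrable ?M (y s)" if "s \<ge> 0" for s
      using sol that by (simp add: solves_consensus_L2_def L2_space_iff)
    have der: "L2_derivative ?M y (generator (y s)) s" if s: "s \<ge> 0" for s
    proof -
      note [measurable] = y[OF s]
      have ys: "y s \<in> borel_measurable ?M" by measurable
      let ?q = "\<lambda>u x. (y u x - y s x) / (u - s)"
      have lim: "((\<lambda>u. (L2_norm \<Omega> (\<lambda>x. ?q u x - interaction_operator \<Omega> \<kappa> (y s) x))\<^sup>2) \<longlongrightarrow> 0\<^sup>2) (at s within {0..})"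
        using sol s by (intro tendsto_power) (simp add: solves_consensus_L2_def)
      have eq: "(L2_norm \<Omega> (\<lambda>x. ?q u x - interaction_operator \<Omega> \<kappa> (y s) x))\<^sup>2
          = (\<integral>x. (?q u x - generator (y s) x)\<^sup>2 \<partial>?M)" if u: "u \<ge> 0" for u
      proof -
        note [measurable] = y[OF u]
        have [measurable]: "y u \<in> borel_measurable ?M" "interaction_operator \<Omega> \<kappa> (y s) \<in> borel_measurable ?M"
          "generator (y s) \<in> borel_measurable ?M"
          using ys operator_meas[OF ys] A_meas[OF ys] unfolding A_eq by measurable
        have "(\<integral>x. (?q u x - interaction_operator \<Omega> \<kappa> (y s) x)\<^sup>2 \<partial>?M) = (\<integral>x. (?q u x - generator (y s) x)\<^sup>2 \<partial>?M)"
          using operator_eq[OF ys] unfolding A_eq by (intro integral_cong_AE) (auto elim!: eventually_mono)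
        then show ?thesis by (simp add: norm_eq)
      qed
      show ?thesis
        unfolding L2_derivative_def
        by (rule Lim_transform_eventually[OF lim[unfolded zero_power2]])
           (auto simp: eventually_at_filter eq)
    qed
    let ?m = "\<integral>x. y t x * v x \<partial>?M"
    have mean: "weighted_mean_L2 \<Omega> v (y t) = (\<lambda>_. ?m)"
      by (simp add: weighted_mean_L2_def L2_inner_def)
    note [measurable] = y[of 0, simplified] y0[unfolded L2_space_iff]
    have init_eq: "(\<integral>x. (y 0 x - ?m)\<^sup>2 \<partial>?M) = (\<integral>x. (y0 x - ?m)\<^sup>2 \<partial>?M)"
      using init by (intro integral_cong_AE) (auto elim!: eventually_mono)
    have "\<forall>t\<ge>0. square_integrable ?M (y t) \<and> L2_derivative ?M y (generator (y t)) t"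
      using y der by blast
    from spec[OF decay, of y, THEN mp, OF this, THEN spec, THEN mp, OF t]
    have "(\<integral>x. (y t x - ?m)\<^sup>2 \<partial>?M) \<le> K * (\<integral>x. (y0 x - ?m)\<^sup>2 \<partial>?M) * exp (- \<rho> * t)"
      unfolding init_eq .
    then have "L2_norm \<Omega> (\<lambda>x. y t x - ?m) \<le> sqrt (K * (\<integral>x. (y0 x - ?m)\<^sup>2 \<partial>?M) * exp (- \<rho> * t))"
      unfolding norm_eq by (rule real_sqrt_le_mono)
    also have "\<dots> = sqrt K * L2_norm \<Omega> (\<lambda>x. y0 x - ?m) * sqrt (exp (- \<rho> * t))"
      by (simp add: norm_eq real_sqrt_mult)
    also have "sqrt (exp (- \<rho> * t)) = exp (- (\<rho> / 2) * t)"
      by (intro real_sqrt_unique) (simp_all flip: exp_of_nat_mult)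
    finally show "L2_norm \<Omega> (\<lambda>x. y t x - weighted_mean_L2 \<Omega> v (y t) x)
        \<le> sqrt K * L2_norm \<Omega> (\<lambda>x. y0 x - weighted_mean_L2 \<Omega> v (y t) x) * exp (- (\<rho> / 2) * t)"
      by (simp add: mean)
  qed
qed

section \<open>From decay at the full rate to the rates below it\<close>

text \<open>The same constant K works for every smaller rate, since t \<ge> 0. \<open>g\<close> may
  depend on t because the weighted mean is written at time t.\<close>

lemma weaken_decay_rate:
  fixes \<rho> K :: real and f :: "'y \<Rightarrow> real \<Rightarrow> real" and g :: "'y \<Rightarrow> 'z \<Rightarrow> real \<Rightarrow> real"
  assumes "\<rho> > 0" "K > 0" and g: "\<And>y y0 t. 0 \<le> g y y0 t"
    and bound: "\<And>y y0 t. P y y0 \<Longrightarrow> t \<ge> 0 \<Longrightarrow> f y t \<le> K * g y y0 t * exp (- \<rho> * t)"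
  shows "\<exists>\<rho>>0. \<forall>\<epsilon>. 0 < \<epsilon> \<and> \<epsilon> < \<rho> \<longrightarrow> (\<exists>M>0. \<forall>y y0. P y y0 \<longrightarrow>
      (\<forall>t\<ge>0. f y t \<le> M * g y y0 t * exp ((- \<rho> + \<epsilon>) * t)))"
proof (rule exI[of _ \<rho>], rule conjI[OF assms(1)], rule allI, rule impI, rule exI[of _ K],
    rule conjI[OF assms(2)], intro allI impI)
  fix \<epsilon> y y0 and t :: real
  assume \<epsilon>: "0 < \<epsilon> \<and> \<epsilon> < \<rho>" and "P y y0" and t: "0 \<le> t"
  have "exp (- \<rho> * t) \<le> exp ((- \<rho> + \<epsilon>) * t)"
    using \<epsilon> t by (simp add: algebra_simps)
  then have "K * g y y0 t * exp (- \<rho> * t) \<le> K * g y y0 t * exp ((- \<rho> + \<epsilon>) * t)"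
    using \<open>K > 0\<close> g by (intro mult_left_mono) auto
  with bound[OF \<open>P y y0\<close> t] show "f y t \<le> K * g y y0 t * exp ((- \<rho> + \<epsilon>) * t)"
    by linarith
qed

theorem theorem2:
  fixes \<sigma> :: "real^'n^'n"
    and \<Omega> :: "(real^'d) set" and \<kappa> :: "real^'d \<Rightarrow> real^'d \<Rightarrow> real" and v :: "real^'d \<Rightarrow> real"
  shows
    "((\<forall>i j. \<sigma> $ i $ j \<ge> 0) \<and> graph_strongly_connected \<sigma> \<longrightarrow>
        (\<exists>\<rho>>0. \<forall>\<epsilon>. 0 < \<epsilon> \<and> \<epsilon> < \<rho> \<longrightarrow>
          (\<exists>M>0. \<forall>y y0. solves_consensus \<sigma> y \<and> y 0 = y0 \<longrightarrow>
            (\<forall>t\<ge>0. norm (y t - weighted_mean (weight_vector \<sigma>) (y t))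
                   \<le> M * norm (y0 - weighted_mean (weight_vector \<sigma>) (y t)) * exp ((- \<rho> + \<epsilon>) * t)))))
     \<and>
     (open \<Omega> \<and> bounded \<Omega> \<and> measure lebesgue \<Omega> = 1 \<and>
      interaction_function \<Omega> \<kappa> \<and> graph_strongly_connected_L2 \<Omega> \<kappa> \<and> weight_function \<Omega> \<kappa> v \<longrightarrow>
        (\<exists>\<rho>>0. \<forall>\<epsilon>. 0 < \<epsilon> \<and> \<epsilon> < \<rho> \<longrightarrow>
          (\<exists>M>0. \<forall>y y0. solves_consensus_L2 \<Omega> \<kappa> y \<and> y0 \<in> L2_space \<Omega> \<and>
                         (AE x in lebesgue_on \<Omega>. y 0 x = y0 x) \<longrightarrow>
            (\<forall>t\<ge>0. L2_norm \<Omega> (\<lambda>x. y t x - weighted_mean_L2 \<Omega> v (y t) x)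
                   \<le> M * L2_norm \<Omega> (\<lambda>x. y0 x - weighted_mean_L2 \<Omega> v (y t) x)
                       * exp ((- \<rho> + \<epsilon>) * t)))))"
proof (intro conjI impI, goal_cases)
  case 1
  then have \<sigma>: "\<And>i j. \<sigma> $ i $ j \<ge> 0" "graph_strongly_connected \<sigma>" by auto
  obtain \<rho> M where "\<rho> > 0" "M > 0"
    "\<And>y t. solves_consensus \<sigma> y \<Longrightarrow> t \<ge> 0 \<Longrightarrow>
       norm (y t - weighted_mean (weight_vector \<sigma>) (y t))
         \<le> M * norm (y 0 - weighted_mean (weight_vector \<sigma>) (y t)) * exp (- \<rho> * t)"
    using consensus_exponential_decay[OF \<sigma>] by blast
  then show ?case
    by (intro weaken_decay_rate[of \<rho> M "\<lambda>y y0 t. norm (y0 - weighted_mean (weight_vector \<sigma>) (y t))"]) auto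
next
  case 2
  then obtain \<rho> K where "\<rho> > 0" "K > 0"
    "\<And>y y0 t. solves_consensus_L2 \<Omega> \<kappa> y \<Longrightarrow> y0 \<in> L2_space \<Omega> \<Longrightarrow> (AE x in lebesgue_on \<Omega>. y 0 x = y0 x) \<Longrightarrow> t \<ge> 0 \<Longrightarrow>
      L2_norm \<Omega> (\<lambda>x. y t x - weighted_mean_L2 \<Omega> v (y t) x)
        \<le> K * L2_norm \<Omega> (\<lambda>x. y0 x - weighted_mean_L2 \<Omega> v (y t) x) * exp (- \<rho> * t)"
    using L2_consensus_exponential_decay[of \<Omega> \<kappa> v] by blast
  then show ?case
    by (intro weaken_decay_rate[of \<rho> K "\<lambda>y y0 t. L2_norm \<Omega> (\<lambda>x. y0 x - weighted_mean_L2 \<Omega> v (y t) x)"])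
       (auto simp: L2_norm_def L2_inner_def)
qed

end
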